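(* Both of the following statements hold. (1) Let $G$ be a finite simple graph with exactly $n$ non-isolated vertices ($G$ may also have isolated vertices). If $k$ is an integer with $1\le k\le n-2$, then $$s_k(G)\le e(G)+k\,\nu(G).$$ (2) Let $G$ be a finite simple graph of order $n$ (that is, with $n$ vertices in total). If $k$ is an integer with $\tau(G)\le k\le n$, then $$s_k(G)\le e(G)+k\,\tau(G)-\binom{\tau(G)}{2}.$$
   Context: All graphs are finite and simple. For a graph $G$ with vertex set $V(G)$ and edge set $E(G)$, write $e(G)=|E(G)|$. The Laplacian matrix $L(G)$ is the $|V(G)|\times|V(G)|$ matrix with $L(G)_{u,u}=d(u)$ (the degree of $u$), $L(G)_{u,v}=-1$ if $uv\in E(G)$, and $L(G)_{u,v}=0$ otherwise. Its eigenvalues, listed with multiplicity, are ordered $\lambda_1(G)\ge\lambda_2(G)\ge\cdots\ge\lambda_{|V(G)|}(G)=0$. For $0\le k\le |V(G)|$, $s_k(G)=\sum_{i=1}^k\lambda_i(G)$ (so $s_0(G)=0$). A vertex is isolated if its degree is $0$. $\nu(G)$ is the matching number of $G$ (the maximum number of pairwise disjoint edges), and $\tau(G)$ is the vertex-cover number of $G$ (the minimum size of a set of vertices meeting every edge). *)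

theory Defs
  imports
    "HOL-Library.Multiset"
    "HOL-Computational_Algebra.Polynomial"
    "Jordan_Normal_Form.Char_Poly"
begin

section \<open>Finite simple graphs\<close>

text \<open>A graph is given by its vertex set and its edge set; an edge is the two-element set of its
  ends. The empty graph is allowed.\<close>

definition simple_graph :: "'a set \<Rightarrow> 'a set set \<Rightarrow> bool" where
  "simple_graph V E \<longleftrightarrow> finite V \<and> (\<forall>e\<in>E. e \<subseteq> V \<and> card e = 2)"

definition vdegree :: "'a set set \<Rightarrow> 'a \<Rightarrow> nat" where
  "vdegree E v = card {e \<in> E. v \<in> e}"

definition non_isolated :: "'a set \<Rightarrow> 'a set set \<Rightarrow> 'a set" where
  "non_isolated V E = {v \<in> V. vdegree E v \<noteq> 0}"

definition matching :: "'a set set \<Rightarrow> 'a set set \<Rightarrow> bool" where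
  "matching E M \<longleftrightarrow> M \<subseteq> E \<and> pairwise disjnt M"

definition matching_number :: "'a set set \<Rightarrow> nat" where
  "matching_number E = Max (card ` {M. matching E M})"

definition vertex_cover :: "'a set \<Rightarrow> 'a set set \<Rightarrow> 'a set \<Rightarrow> bool" where
  "vertex_cover V E C \<longleftrightarrow> C \<subseteq> V \<and> (\<forall>e\<in>E. C \<inter> e \<noteq> {})"

definition vertex_cover_number :: "'a set \<Rightarrow> 'a set set \<Rightarrow> nat" where
  "vertex_cover_number V E = Min (card ` {C. vertex_cover V E C})"


section \<open>The Laplacian matrix and its eigenvalues\<close>

definition laplacian_entry :: "'a set set \<Rightarrow> 'a \<Rightarrow> 'a \<Rightarrow> real" where
  "laplacian_entry E u v =
    (if u = v then real (vdegree E u) else if {u, v} \<in> E then -1 else 0)"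

text \<open>Matrices are indexed by natural numbers, so the rows and columns are numbered along a list of
  the vertices. The characteristic polynomial does not depend on the list (lemma
  \<open>char_poly_laplacian_list\<close> below), so the eigenvalues are those of any numbering.\<close>

definition laplacian_list :: "'a set set \<Rightarrow> 'a list \<Rightarrow> real mat" where
  "laplacian_list E vs =
    mat (length vs) (length vs) (\<lambda>(i, j). laplacian_entry E (vs ! i) (vs ! j))"

definition vertex_list :: "'a set \<Rightarrow> 'a list" where
  "vertex_list V = (SOME vs. distinct vs \<and> set vs = V)"

definition laplacian :: "'a set \<Rightarrow> 'a set set \<Rightarrow> real mat" where
  "laplacian V E = laplacian_list E (vertex_list V)"

text \<open>The eigenvalues with multiplicity are the real roots of the characteristic polynomial; for a
  graph these are all of its roots (lemma \<open>length_laplacian_eigenvalues\<close> below).\<close>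

definition laplacian_eigenvalues :: "'a set \<Rightarrow> 'a set set \<Rightarrow> real list" where
  "laplacian_eigenvalues V E =
    rev (sorted_list_of_multiset (proots (char_poly (laplacian V E))))"

text \<open>The eigenvalues are numbered from 1, in non-increasing order.\<close>

definition laplacian_eigenvalue :: "'a set \<Rightarrow> 'a set set \<Rightarrow> nat \<Rightarrow> real" where
  "laplacian_eigenvalue V E i = laplacian_eigenvalues V E ! (i - 1)"

definition laplacian_sum :: "'a set \<Rightarrow> 'a set set \<Rightarrow> nat \<Rightarrow> real" where
  "laplacian_sum V E k = (\<Sum>i = 1..k. laplacian_eigenvalue V E i)"


section \<open>The eigenvalues are well defined\<close>

lemma vertex_list:
  assumes "finite V"
  shows "distinct (vertex_list V)" "set (vertex_list V) = V" "length (vertex_list V) = card V"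
proof -
  have "\<exists>vs. distinct vs \<and> set vs = V"
    using finite_distinct_list[OF assms] by blast
  from someI_ex[OF this] show *: "distinct (vertex_list V)" "set (vertex_list V) = V"
    by (auto simp: vertex_list_def)
  show "length (vertex_list V) = card V"
    using * distinct_card by metis
qed

lemma det_permute_both:
  fixes A :: "'b :: comm_ring_1 mat"
  assumes A: "A \<in> carrier_mat n n" and p: "p permutes {0..<n}"
  shows "det (mat n n (\<lambda>(i, j). A $$ (p i, p j))) = det A"
proof -
  have pn: "p i < n" if "i < n" for i
    using permutes_in_image[OF p, of i] that by auto
  define B where "B = mat n n (\<lambda>(i, j). A $$ (p i, j))"
  have B: "B \<in> carrier_mat n n" by (simp add: B_def)
  have "mat n n (\<lambda>(i, j). A $$ (p i, p j)) =
      transpose_mat (mat n n (\<lambda>(i, j). transpose_mat B $$ (p i, j)))"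
    by (rule eq_matI) (use pn A in \<open>auto simp: B_def\<close>)
  hence "det (mat n n (\<lambda>(i, j). A $$ (p i, p j))) =
      det (mat n n (\<lambda>(i, j). transpose_mat B $$ (p i, j)))"
    by (simp add: det_transpose[of _ n])
  also have "\<dots> = signof p * det (transpose_mat B)"
    using B by (intro det_permute_rows p) auto
  also have "\<dots> = signof p * (signof p * det A)"
    using det_permute_rows[OF A p] det_transpose[OF B] by (simp add: B_def)
  also have "\<dots> = det A"
    by (simp add: sign_def)
  finally show ?thesis .
qed

lemma char_poly_laplacian_list:
  assumes "distinct vs" "distinct ws" "set vs = set ws"
  shows "char_poly (laplacian_list E vs) = char_poly (laplacian_list E ws)"
proof -
  define n where "n = length ws"
  have "mset vs = mset ws"
    using assms by (simp add: set_eq_iff_mset_eq_distinct)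
  then obtain p where p: "p permutes {..<length ws}" and vs: "permute_list p ws = vs"
    by (rule mset_eq_permutation)
  have pn: "p i < n" if "i < n" for i
    using permutes_in_image[OF p, of i] that by (auto simp: n_def)
  have len: "length vs = n" using vs by (auto simp: n_def)
  have nth: "vs ! i = ws ! p i" if "i < n" for i
    using permute_list_nth[OF p] that vs by (simp add: n_def)
  have p': "p permutes {0..<n}" using p by (simp add: n_def atLeast0LessThan)
  have inj: "p i = p j \<longleftrightarrow> i = j" for i j
    using permutes_inj[OF p] by (auto dest: injD)
  let ?A = "char_poly_matrix (laplacian_list E ws)"
  have A: "?A \<in> carrier_mat n n"
    by (simp add: char_poly_matrix_def laplacian_list_def n_def)
  have "char_poly_matrix (laplacian_list E vs) = mat n n (\<lambda>(i, j). ?A $$ (p i, p j))"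
    by (rule eq_matI)
      (use pn in \<open>auto simp: char_poly_matrix_def laplacian_list_def len nth inj simp flip: n_def\<close>)
  thus ?thesis
    using det_permute_both[OF A p'] by (simp add: char_poly_def)
qed

lemma symmetric_eigenvalue_real:
  fixes A :: "real mat"
  assumes A: "A \<in> carrier_mat n n"
    and sym: "\<And>i j. i < n \<Longrightarrow> j < n \<Longrightarrow> A $$ (i, j) = A $$ (j, i)"
    and ev: "eigenvalue (map_mat complex_of_real A) a"
  shows "a \<in> \<real>"
proof -
  let ?C = "map_mat complex_of_real A"
  obtain v where v: "v \<in> carrier_vec n" "v \<noteq> 0\<^sub>v n" "?C *\<^sub>v v = a \<cdot>\<^sub>v v"
    using ev A unfolding eigenvalue_def eigenvector_def by auto
  have row: "(\<Sum>j<n. of_real (A $$ (i, j)) * v $ j) = a * v $ i" if "i < n" for i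
  proof -
    have "(?C *\<^sub>v v) $ i = (a \<cdot>\<^sub>v v) $ i" using v by simp
    thus ?thesis using that A v(1) by (simp add: scalar_prod_def atLeast0LessThan)
  qed
  define q where "q = (\<Sum>i<n. \<Sum>j<n. cnj (v $ i) * (of_real (A $$ (i, j)) * v $ j))"
  define N where "N = (\<Sum>i<n. (cmod (v $ i))\<^sup>2)"
  have "q = (\<Sum>i<n. cnj (v $ i) * (a * v $ i))"
    unfolding q_def by (intro sum.cong refl) (simp add: row flip: sum_distrib_left)
  also have "\<dots> = a * of_real N"
    unfolding N_def of_real_sum sum_distrib_left
    by (intro sum.cong refl) (simp add: complex_norm_square mult_ac del: of_real_power)
  finally have qN: "q = a * of_real N" .
  have "cnj q = (\<Sum>i<n. \<Sum>j<n. v $ i * (of_real (A $$ (i, j)) * cnj (v $ j)))"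
    by (simp add: q_def)
  also have "\<dots> = (\<Sum>j<n. \<Sum>i<n. v $ i * (of_real (A $$ (i, j)) * cnj (v $ j)))"
    by (rule sum.swap)
  also have "\<dots> = q"
    unfolding q_def using sym by (intro sum.cong refl) (simp add: mult.commute mult.left_commute)
  finally have "cnj q = q" .
  hence "cnj a * of_real N = a * of_real N"
    by (simp add: qN)
  moreover have "N \<noteq> 0"
  proof
    assume "N = 0"
    hence "\<forall>i<n. v $ i = 0"
      unfolding N_def by (subst (asm) sum_nonneg_eq_0_iff) auto
    hence "v = 0\<^sub>v n" using v(1) by (intro eq_vecI) auto
    with v(2) show False by simp
  qed
  ultimately have "cnj a = a" by simp
  thus ?thesis by (simp add: Reals_cnj_iff)
qed

lemma size_proots_char_poly_symmetric:
  fixes A :: "real mat"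
  assumes A: "A \<in> carrier_mat n n"
    and sym: "\<And>i j. i < n \<Longrightarrow> j < n \<Longrightarrow> A $$ (i, j) = A $$ (j, i)"
  shows "size (proots (char_poly A)) = n"
proof -
  let ?C = "map_mat complex_of_real A"
  have C: "?C \<in> carrier_mat n n" using A by simp
  interpret h: map_poly_inj_comm_ring_hom complex_of_real
    by unfold_locales auto
  obtain as where as: "char_poly ?C = (\<Prod>a\<leftarrow>as. [:- a, 1:])" and len: "length as = n"
    using char_poly_factorized[OF C] by blast
  have real: "a \<in> \<real>" if "a \<in> set as" for a
  proof (rule symmetric_eigenvalue_real[OF A sym])
    have "poly (char_poly ?C) a = 0"
      using that unfolding as poly_prod_list by (auto simp: prod_list_zero_iff)
    thus "eigenvalue ?C a" using eigenvalue_root_char_poly[OF C] by simp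
  qed
  have "map_poly of_real (char_poly A) = char_poly ?C"
    by (rule of_real_hom.char_poly_hom[OF A, symmetric])
  also have "\<dots> = map_poly complex_of_real (\<Prod>a\<leftarrow>as. [:- Re a, 1:])"
    unfolding as h.hom_prod_list map_map
    by (intro arg_cong[of _ _ prod_list] map_cong refl) (use real in \<open>auto simp: of_real_Re\<close>)
  finally have "char_poly A = (\<Prod>a\<leftarrow>as. [:- Re a, 1:])"
    by (rule h.injectivity)
  moreover have "size (proots (\<Prod>a\<leftarrow>xs. [:- Re a, 1:])) = length xs" for xs
  proof (induction xs)
    case (Cons x xs)
    have "(\<Prod>a\<leftarrow>xs. [:- Re a, 1:]) \<noteq> 0"
      by (auto simp: prod_list_zero_iff)
    hence "proots ([:- Re x, 1:] * (\<Prod>a\<leftarrow>xs. [:- Re a, 1:])) =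
        proots [:- Re x, 1:] + proots (\<Prod>a\<leftarrow>xs. [:- Re a, 1:])"
      by (intro proots_mult) auto
    moreover have "size (proots [:- Re x, 1:]) = 1"
      using proots_linear_factor[of "- Re x"] by simp
    ultimately show ?case using Cons by simp
  qed simp
  ultimately show ?thesis using len by simp
qed

lemma length_laplacian_eigenvalues:
  assumes "simple_graph V E"
  shows "length (laplacian_eigenvalues V E) = card V"
proof -
  have "size (proots (char_poly (laplacian V E))) = card V"
    using assms vertex_list(3)[of V]
    by (intro size_proots_char_poly_symmetric)
      (auto simp: laplacian_def laplacian_list_def laplacian_entry_def simple_graph_def
        insert_commute)
  thus ?thesis
    unfolding laplacian_eigenvalues_def
    by (metis length_rev mset_sorted_list_of_multiset size_mset)
qed

end

(* A trace bound that rests on maximality. Let j = |V| - k and let the rows of Y span the left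
   invariant space of the j smallest Laplacian eigenvalues. Among all partitions of V into j blocks
   choose one that maximises |det (Y X)|, where the columns of X are the indicator vectors of the
   blocks, and put l = (Y X)^-1 Y. Moving u from its block B to a block C multiplies the determinant
   by 1 - l_B(u) + l_C(u), so x_u = l_B(u) - l_C(u) >= 0, and the x_u sum to 1 over B. The sum of the
   j smallest eigenvalues is the trace of X (Y X)^-1 Y L, which is the sum of x_u + x_v over the edges
   uv between different blocks. Hence s_k - e(G) is the number of edges inside blocks plus the sum of
   1 - x_u - x_v <= (1 - x_u)(1 - x_v) over the other edges. Over all pairs of vertices these weights
   sum to k(k+1)/2, which is Brouwer's bound; the pairs at one vertex have total weight at most k.

   For the vertex cover bound, the pairs avoiding a cover C still have total weight at least
   r(r+1)/2 with r >= k - |C|. For the matching bound with k >= 2 nu, cover the edges by vertices (each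
   costing k) and vertex sets W (each costing at most |W|(|W|-1)/2) as in the Tutte-Berge formula;
   the one case where this is too weak has all edges inside a set of k+1 vertices. *)
theory Submission
  imports Defs "Jordan_Normal_Form.Schur_Decomposition"
begin

section \<open>Left invariant subspaces and determinants\<close>

lemma monic_eq_prod_proots:
  fixes p :: "'b :: field poly"
  assumes "monic p" "size (proots p) = degree p"
  shows "p = (\<Prod>x\<in>#proots p. [:- x, 1:])"
  using assms
proof (induction "degree p" arbitrary: p)
  case 0
  then have "p = 1" using monic_degree_0[of p] by simp
  then show ?case by simp
next
  case (Suc d)
  then have "proots p \<noteq> {#}" by auto
  then obtain x where "x \<in># proots p" by blast
  moreover have "p \<noteq> 0" using Suc.prems(1) by auto
  ultimately have "poly p x = 0" by simp
  then obtain q where p: "p = [:- x, 1:] * q" by (auto simp: poly_eq_0_iff_dvd)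
  have "lead_coeff p = lead_coeff q" unfolding p lead_coeff_mult by simp
  with Suc.prems(1) have q: "q \<noteq> 0" "monic q" by auto
  have deg: "degree p = Suc (degree q)" using q unfolding p by (subst degree_mult_eq) auto
  have pr: "proots p = add_mset x (proots q)"
    unfolding p using q by (subst proots_mult) auto
  have "q = (\<Prod>x\<in>#proots q. [:- x, 1:])"
    using Suc deg pr q by (intro Suc.hyps(1)) auto
  with p pr show ?case by simp
qed

text \<open>\<open>g c\<close> is column \<open>c\<close>. With columns as functions, replacing one
  of them is a function update.\<close>

definition cdet :: "nat \<Rightarrow> (nat \<Rightarrow> nat \<Rightarrow> real) \<Rightarrow> real" where
  "cdet j g = det (mat j j (\<lambda>(r, c). g c r))"

lemma cdet_cong:
  assumes "\<And>c r. c < j \<Longrightarrow> r < j \<Longrightarrow> g c r = h c r"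
  shows "cdet j g = cdet j h"
  unfolding cdet_def by (intro arg_cong[of _ _ det] eq_matI) (use assms in auto)

lemma cdet_unit: "cdet j (\<lambda>c r. if r = c then 1 else 0) = 1"
proof -
  have "mat j j (\<lambda>(r, c). if r = c then 1 else 0) = (1\<^sub>m j :: real mat)"
    by (rule eq_matI) auto
  then show ?thesis by (simp add: cdet_def)
qed

text \<open>Cramer's rule: multiples of the other columns do not affect the determinant, so only the
  coefficient of column \<open>b\<close> survives.\<close>

lemma cdet_update:
  assumes b: "b < j" and v: "\<And>r. r < j \<Longrightarrow> v r = (\<Sum>c<j. x c * g c r)"
  shows "cdet j (g(b := v)) = x b * cdet j g"
proof -
  define A where "A = mat j j (\<lambda>(r, c). g c r)"
  have A: "A \<in> carrier_mat j j" by (simp add: A_def)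
  have "A *\<^sub>v vec j x = vec j v"
    by (rule eq_vecI) (auto simp: A_def v scalar_prod_def atLeast0LessThan mult.commute)
  moreover have "mat j j (\<lambda>(r, c). (g(b := v)) c r) = replace_col A (vec j v) b"
    by (rule eq_matI) (auto simp: A_def replace_col_def)
  ultimately show ?thesis
    using cramer_lemma_mat[OF A, of "vec j x" b] b by (simp add: cdet_def A_def)
qed

text \<open>\<open>N\<close> is the inverse matrix. Its row \<open>c\<close> reads off coordinate
  \<open>c\<close> in the basis of columns of \<open>g\<close>, and the first identity rebuilds a
  vector from its coordinates.\<close>

lemma cdet_inverse:
  assumes "cdet j g \<noteq> 0"
  obtains N :: "nat \<Rightarrow> nat \<Rightarrow> real" where
    "\<And>r s. r < j \<Longrightarrow> s < j \<Longrightarrow> (\<Sum>c<j. g c r * N c s) = (if r = s then 1 else 0)"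
    "\<And>c d. c < j \<Longrightarrow> d < j \<Longrightarrow> (\<Sum>r<j. N c r * g d r) = (if c = d then 1 else 0)"
proof -
  define A where "A = mat j j (\<lambda>(r, c). g c r)"
  have A: "A \<in> carrier_mat j j" by (simp add: A_def)
  have "det A \<noteq> 0" using assms by (simp add: A_def cdet_def)
  from det_non_zero_imp_unit[OF A this, of "()"] obtain B where
    B: "B \<in> carrier_mat j j" and BA: "B * A = 1\<^sub>m j" and AB: "A * B = 1\<^sub>m j"
    by (auto simp: Units_def ring_mat_def)
  show thesis
  proof
    show "(\<Sum>c<j. g c r * B $$ (c, s)) = (if r = s then 1 else 0)" if "r < j" "s < j" for r s
    proof -
      have "(A * B) $$ (r, s) = (if r = s then 1 else 0)" using AB that by simp
      then show ?thesis using that A B by (simp add: A_def scalar_prod_def atLeast0LessThan)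
    qed
    show "(\<Sum>r<j. B $$ (c, r) * g d r) = (if c = d then 1 else 0)" if "c < j" "d < j" for c d
    proof -
      have "(B * A) $$ (c, d) = (if c = d then 1 else 0)" using BA that by simp
      then show ?thesis using that A B by (simp add: A_def scalar_prod_def atLeast0LessThan)
    qed
  qed
qed

text \<open>In a Schur form \<open>L = P * B * Q\<close> one has \<open>Q * L = B * Q\<close> with
  \<open>B\<close> upper triangular, so the last \<open>n - k\<close> rows of \<open>Q\<close> span
  a left invariant space. \<open>T\<close> is the lower right corner of \<open>B\<close>; the last
  columns of \<open>P\<close> form \<open>Z\<close> and witness the independence of the
  rows.\<close>

lemma lower_invariant_rows:
  fixes L :: "real mat"
  assumes L: "L \<in> carrier_mat n n" and cp: "char_poly L = (\<Prod>a\<leftarrow>es. [:- a, 1:])" and k: "k \<le> n"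
  obtains Y T Z :: "nat \<Rightarrow> nat \<Rightarrow> real" where
    "\<And>r u. r < n - k \<Longrightarrow> u < n \<Longrightarrow>
      (\<Sum>v<n. Y r v * L $$ (v, u)) = (\<Sum>s<n - k. T r s * Y s u)"
    "(\<Sum>r<n - k. T r r) = (\<Sum>i=k..<n. es ! i)"
    "\<And>r s. r < n - k \<Longrightarrow> s < n - k \<Longrightarrow> (\<Sum>u<n. Y r u * Z u s) = (if r = s then 1 else 0)"
proof -
  obtain B P Q where schur: "schur_decomposition L es = (B, P, Q)"
    by (cases "schur_decomposition L es") auto
  from schur_decomposition[OF L cp schur]
  have sim: "similar_mat_wit L B P Q" and tri: "upper_triangular B" and diag: "diag_mat B = es"
    by auto
  from similar_mat_witD2[OF L sim]
  have PQ: "P * Q = 1\<^sub>m n" and QP: "Q * P = 1\<^sub>m n" and LB: "L = P * B * Q"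
    and B: "B \<in> carrier_mat n n" and P: "P \<in> carrier_mat n n" and Q: "Q \<in> carrier_mat n n" by auto
  have "Q * L = Q * (P * (B * Q))" unfolding LB using P B Q by (simp add: assoc_mult_mat[of _ n n _ n _ n])
  also have "\<dots> = (Q * P) * (B * Q)" using P B Q by (simp add: assoc_mult_mat[of _ n n _ n _ n])
  finally have QL: "Q * L = B * Q" using QP B Q by simp
  have shift: "(\<Sum>i=k..<n. f i) = (\<Sum>r<n - k. f (k + r))" for f :: "nat \<Rightarrow> real"
    using sum.shift_bounds_nat_ivl[of f 0 k "n - k"] k by (simp add: atLeast0LessThan add.commute)
  show thesis
  proof
    fix r u assume r: "r < n - k" and u: "u < n"
    have "(\<Sum>v<n. Q $$ (k + r, v) * L $$ (v, u)) = (Q * L) $$ (k + r, u)"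
      using r u Q L by (simp add: scalar_prod_def atLeast0LessThan)
    also have "\<dots> = (\<Sum>i<n. B $$ (k + r, i) * Q $$ (i, u))"
      unfolding QL using r u Q B by (simp add: scalar_prod_def atLeast0LessThan)
    also have "\<dots> = (\<Sum>i=k..<n. B $$ (k + r, i) * Q $$ (i, u))"
    \<comment> \<open>In row \<open>k + r\<close> every position \<open>i < k\<close> lies to the
      left of the diagonal, where \<open>B\<close> vanishes.\<close>
    proof (rule sum.mono_neutral_right)
      show "\<forall>i\<in>{..<n} - {k..<n}. B $$ (k + r, i) * Q $$ (i, u) = 0"
        using tri B r by (auto simp: upper_triangular_def)
    qed auto
    also have "\<dots> = (\<Sum>s<n - k. B $$ (k + r, k + s) * Q $$ (k + s, u))" by (rule shift)
    finally show "(\<Sum>v<n. Q $$ (k + r, v) * L $$ (v, u)) =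
        (\<Sum>s<n - k. B $$ (k + r, k + s) * Q $$ (k + s, u))" .
  next
    have "es ! i = B $$ (i, i)" if "i < n" for i
      using diag B that by (auto simp: diag_mat_def)
    then show "(\<Sum>r<n - k. B $$ (k + r, k + r)) = (\<Sum>i=k..<n. es ! i)"
      unfolding shift by (intro sum.cong) auto
  next
    fix r s assume r: "r < n - k" and s: "s < n - k"
    have "(Q * P) $$ (k + r, k + s) = (if r = s then 1 else 0)" using QP r s by simp
    then show "(\<Sum>u<n. Q $$ (k + r, u) * P $$ (u, k + s)) = (if r = s then 1 else 0)"
      using r s Q P by (simp add: scalar_prod_def atLeast0LessThan)
  qed
qed

text \<open>If all rows of \<open>Y\<close> sum to zero, the all-ones row is adjoined to \<open>Y\<close>.\<close>
lemma invariant_rows_not_balanced: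
  fixes L :: "nat \<Rightarrow> nat \<Rightarrow> real" and Y T Z :: "nat \<Rightarrow> nat \<Rightarrow> real"
  assumes YL: "\<And>r u. r < j \<Longrightarrow> u < n \<Longrightarrow> (\<Sum>v<n. Y r v * L v u) = (\<Sum>s<j. T r s * Y s u)"
    and YZ: "\<And>r s. r < j \<Longrightarrow> s < j \<Longrightarrow> (\<Sum>u<n. Y r u * Z u s) = (if r = s then 1 else 0)"
    and L: "\<And>u. u < n \<Longrightarrow> (\<Sum>v<n. L v u) = 0" and n: "0 < n"
  obtains i and Y' T' Z' :: "nat \<Rightarrow> nat \<Rightarrow> real" where "j \<le> i"
    "\<And>r u. r < i \<Longrightarrow> u < n \<Longrightarrow> (\<Sum>v<n. Y' r v * L v u) = (\<Sum>s<i. T' r s * Y' s u)"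
    "\<And>r s. r < i \<Longrightarrow> s < i \<Longrightarrow> (\<Sum>u<n. Y' r u * Z' u s) = (if r = s then 1 else 0)"
    "(\<Sum>r<i. T' r r) = (\<Sum>r<j. T r r)"
    "\<exists>r<i. (\<Sum>u<n. Y' r u) \<noteq> 0"
proof (cases "\<exists>r<j. (\<Sum>u<n. Y r u) \<noteq> 0")
  case True
  show thesis by (rule that[OF order_refl YL YZ refl True])
next
  case False
  \<comment> \<open>The columns of \<open>L\<close> sum to zero, so the all-ones row is a left null
    vector: row 0 of \<open>T'\<close> is zero and the trace does not change.\<close>
  define Y' where "Y' r u = (case r of 0 \<Rightarrow> 1 | Suc r \<Rightarrow> Y r u)" for r u
  define T' where "T' r s = (case r of 0 \<Rightarrow> 0 | Suc r \<Rightarrow> (case s of 0 \<Rightarrow> 0 | Suc s \<Rightarrow> T r s))" for r s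
  \<comment> \<open>Column 0 is dual to the all-ones row and orthogonal to the balanced rows of
    \<open>Y\<close>. The other columns are centred, which makes them orthogonal to the all-ones row
    and keeps their products with balanced rows.\<close>
  define Z' where "Z' u s = (case s of 0 \<Rightarrow> 1 / n | Suc s \<Rightarrow> Z u s - (\<Sum>w<n. Z w s) / n)" for u s
  show thesis
  proof (rule that[of "Suc j" Y' T' Z'])
    fix r u assume "r < Suc j" "u < n"
    then show "(\<Sum>v<n. Y' r v * L v u) = (\<Sum>s<Suc j. T' r s * Y' s u)"
      using L YL unfolding sum.lessThan_Suc_shift by (cases r) (auto simp: Y'_def T'_def)
  next
    fix r s assume "r < Suc j" "s < Suc j"
    then show "(\<Sum>u<n. Y' r u * Z' u s) = (if r = s then 1 else 0)"
      using n False YZ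
      by (cases r; cases s)
        (auto simp: Y'_def Z'_def sum_subtractf right_diff_distrib simp flip: sum_divide_distrib sum_distrib_right)
  next
    show "(\<Sum>r<Suc j. T' r r) = (\<Sum>r<j. T r r)"
      unfolding sum.lessThan_Suc_shift by (simp add: T'_def)
    show "\<exists>r<Suc j. (\<Sum>u<n. Y' r u) \<noteq> 0"
      using n by (intro exI[of _ 0]) (simp add: Y'_def)
  qed auto
qed

section \<open>Partitions with a nonzero block determinant\<close>

definition block_sum :: "nat \<Rightarrow> (nat \<Rightarrow> nat \<Rightarrow> real) \<Rightarrow> (nat \<Rightarrow> nat) \<Rightarrow> nat \<Rightarrow> nat \<Rightarrow> real" where
  "block_sum n Y \<phi> b r = (\<Sum>u | u < n \<and> \<phi> u = b. Y r u)"

text \<open>The block sums add up to the vector \<open>w\<close> of row sums of \<open>Y\<close>, so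
  \<open>w\<close> has to be nonzero. Conversely, \<open>w\<close> extends to a basis by
  \<open>j - 1\<close> columns of \<open>Y\<close>; each of these becomes a singleton block, and all
  remaining vertices form block \<open>p\<close>.\<close>

lemma exists_partition_cdet_nonzero:
  fixes Y Z :: "nat \<Rightarrow> nat \<Rightarrow> real"
  assumes YZ: "\<And>r s. r < j \<Longrightarrow> s < j \<Longrightarrow> (\<Sum>u<n. Y r u * Z u s) = (if r = s then 1 else 0)"
    and p: "p < j" "(\<Sum>u<n. Y p u) \<noteq> 0"
  obtains \<phi> where "\<And>u. u < n \<Longrightarrow> \<phi> u < j" "cdet j (block_sum n Y \<phi>) \<noteq> 0"
proof -
  define w where "w r = (\<Sum>u<n. Y r u)" for r
  \<comment> \<open>The unit vectors with \<open>w\<close> in position \<open>p\<close>: a basis,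
    because \<open>w p\<close> is nonzero.\<close>
  define G where "G = (\<lambda>c r. if r = c then 1 else 0 :: real)(p := w)"
  have "cdet j G = w p * cdet j (\<lambda>c r. if r = c then 1 else 0)"
    unfolding G_def using p(1) by (intro cdet_update) (auto simp: if_distrib cong: if_cong)
  then have G: "cdet j G \<noteq> 0" using p by (simp add: cdet_unit w_def)
  \<comment> \<open>Exchange step: the columns of \<open>Y\<close> span the whole space because of
    \<open>Z\<close>, so one of them has a nonzero coordinate \<open>b\<close> in the basis
    \<open>g\<close> and can replace \<open>g b\<close>.\<close>
  have step: "\<exists>u<n. cdet j (g(b := (\<lambda>r. Y r u))) \<noteq> 0" if g: "cdet j g \<noteq> 0" and b: "b < j" for g b
  proof (rule ccontr)
    assume *: "\<not> ?thesis"
    obtain N where N1: "\<And>r s. r < j \<Longrightarrow> s < j \<Longrightarrow> (\<Sum>c<j. g c r * N c s) = (if r = s then 1 else 0)"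
      and N2: "\<And>c d. c < j \<Longrightarrow> d < j \<Longrightarrow> (\<Sum>r<j. N c r * g d r) = (if c = d then 1 else 0)"
      using cdet_inverse[OF g] by blast
    have coord: "(\<Sum>s<j. N b s * Y s u) = 0" if u: "u < n" for u
    proof -
      have "cdet j (g(b := (\<lambda>r. Y r u))) = (\<Sum>s<j. N b s * Y s u) * cdet j g"
      proof (rule cdet_update[OF b])
        fix r assume r: "r < j"
        have "(\<Sum>c<j. (\<Sum>s<j. N c s * Y s u) * g c r) = (\<Sum>s<j. (\<Sum>c<j. g c r * N c s) * Y s u)"
          unfolding sum_distrib_right by (subst sum.swap) (simp add: mult_ac)
        also have "\<dots> = Y r u" using r by (simp add: N1 if_distrib if_distribR cong: if_cong)
        finally show "Y r u = (\<Sum>c<j. (\<Sum>s<j. N c s * Y s u) * g c r)" ..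
      qed
      with * u g show ?thesis by auto
    qed
    \<comment> \<open>As \<open>Y Z\<close> is the identity, \<open>g b\<close> is a combination of
      columns of \<open>Y\<close>, and coordinate \<open>b\<close> is assumed to vanish on all of
      these.\<close>
    have "1 = (\<Sum>s<j. N b s * g b s)" using N2 b by simp
    also have "\<dots> = (\<Sum>s<j. N b s * (\<Sum>t<j. (\<Sum>u<n. Y s u * Z u t) * g b t))"
      by (intro sum.cong refl) (auto simp: YZ if_distrib if_distribR cong: if_cong)
    also have "\<dots> = (\<Sum>s<j. \<Sum>t<j. \<Sum>u<n. N b s * Y s u * (Z u t * g b t))"
      by (simp add: sum_distrib_left sum_distrib_right mult_ac)
    also have "\<dots> = (\<Sum>s<j. \<Sum>u<n. \<Sum>t<j. N b s * Y s u * (Z u t * g b t))"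
      by (intro sum.cong refl sum.swap)
    also have "\<dots> = (\<Sum>u<n. \<Sum>s<j. \<Sum>t<j. N b s * Y s u * (Z u t * g b t))" by (rule sum.swap)
    also have "\<dots> = (\<Sum>u<n. (\<Sum>s<j. N b s * Y s u) * (\<Sum>t<j. Z u t * g b t))"
      by (simp add: sum_product)
    finally show False using coord by simp
  qed
  have "\<exists>f. (\<forall>b\<in>S. f b < n) \<and> cdet j (\<lambda>c. if c \<in> S then (\<lambda>r. Y r (f c)) else G c) \<noteq> 0"
    if "finite S" "S \<subseteq> {..<j} - {p}" for S using that
  proof (induction S)
    case empty then show ?case using G by simp
  next
    case (insert b S)
    then obtain f where f: "\<forall>b\<in>S. f b < n"
      "cdet j (\<lambda>c. if c \<in> S then (\<lambda>r. Y r (f c)) else G c) \<noteq> 0" by auto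
    from step[OF f(2), of b] insert.prems obtain u where u: "u < n"
      "cdet j ((\<lambda>c. if c \<in> S then (\<lambda>r. Y r (f c)) else G c)(b := (\<lambda>r. Y r u))) \<noteq> 0" by auto
    have "(\<lambda>c. if c \<in> S then (\<lambda>r. Y r (f c)) else G c)(b := (\<lambda>r. Y r u)) =
        (\<lambda>c. if c \<in> insert b S then (\<lambda>r. Y r ((f(b := u)) c)) else G c)"
      using insert.hyps by (auto simp: fun_eq_iff)
    with u f(1) insert.hyps show ?case by (intro exI[of _ "f(b := u)"]) auto
  qed
  from this[of "{..<j} - {p}"] obtain f where f: "\<And>b. b < j \<Longrightarrow> b \<noteq> p \<Longrightarrow> f b < n"
    and f': "cdet j (\<lambda>c. if c \<in> {..<j} - {p} then (\<lambda>r. Y r (f c)) else G c) \<noteq> 0" by auto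
  define g where "g = (\<lambda>c. if c \<in> {..<j} - {p} then (\<lambda>r. Y r (f c)) else G c)"
  have g: "cdet j g \<noteq> 0" using f' by (simp add: g_def)
  have inj: "inj_on f ({..<j} - {p})"
  proof (rule inj_onI, rule ccontr)
    fix b c assume bc: "b \<in> {..<j} - {p}" "c \<in> {..<j} - {p}" "f b = f c" "b \<noteq> c"
    \<comment> \<open>Replacing a column by an equal one changes nothing, yet it multiplies the
      determinant by 0.\<close>
    have "cdet j (g(b := g c)) = (if b = c then 1 else 0) * cdet j g"
      using bc by (intro cdet_update) (auto simp: if_distrib if_distribR cong: if_cong)
    moreover have "g(b := g c) = g" using bc by (auto simp: g_def fun_eq_iff)
    ultimately show False using g bc by simp
  qed
  define \<phi> where "\<phi> u = (if u \<in> f ` ({..<j} - {p}) then the_inv_into ({..<j} - {p}) f u else p)" for u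
  have phi_f: "\<phi> (f b) = b" if "b < j" "b \<noteq> p" for b
    using that by (auto simp: \<phi>_def the_inv_into_f_f[OF inj])
  have phi_p: "\<phi> u = p" if "u \<notin> f ` ({..<j} - {p})" for u using that by (auto simp: \<phi>_def)
  have phi_less: "\<phi> u < j" for u
  proof (cases "u \<in> f ` ({..<j} - {p})")
    case True
    then obtain b where "b < j" "b \<noteq> p" "u = f b" by auto
    then show ?thesis using phi_f by simp
  qed (use phi_p p(1) in simp)
  have fib: "{u. u < n \<and> \<phi> u = b} = {f b}" if "b < j" "b \<noteq> p" for b
  proof (intro equalityI subsetI)
    fix u assume "u \<in> {u. u < n \<and> \<phi> u = b}"
    then have u: "\<phi> u = b" by simp
    with that(2) phi_p have "u \<in> f ` ({..<j} - {p})" by blast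
    then obtain c where "c < j" "c \<noteq> p" "u = f c" by auto
    with phi_f u show "u \<in> {f b}" by simp
  qed (use phi_f f that in simp)
  have fibp: "{u. u < n \<and> \<phi> u = p} = {..<n} - f ` ({..<j} - {p})"
  proof (intro equalityI subsetI)
    fix u assume "u \<in> {u. u < n \<and> \<phi> u = p}"
    then have u: "u < n" "\<phi> u = p" by simp_all
    have "u \<noteq> f b" if "b < j" "b \<noteq> p" for b using phi_f[OF that] that u by auto
    with u show "u \<in> {..<n} - f ` ({..<j} - {p})" by auto
  next
    fix u assume "u \<in> {..<n} - f ` ({..<j} - {p})"
    then show "u \<in> {u. u < n \<and> \<phi> u = p}" using phi_p by simp
  qed
  have "cdet j (block_sum n Y \<phi>) = cdet j (g(p := block_sum n Y \<phi> p))"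
    by (rule cdet_cong) (auto simp: block_sum_def fib g_def)
  also have "\<dots> = (if p = p then 1 else - 1) * cdet j g"
  \<comment> \<open>The sum of block \<open>p\<close> is \<open>w\<close> minus the other block
    sums. The factor \<open>if p = p\<close> is this coefficient function at \<open>p\<close>, left
    unsimplified to match \<open>cdet_update\<close>.\<close>
  proof (rule cdet_update[OF p(1), where x = "\<lambda>c. if c = p then 1 else - 1"])
    fix r assume "r < j"
    have "block_sum n Y \<phi> p r = w r - (\<Sum>u\<in>f ` ({..<j} - {p}). Y r u)"
      unfolding block_sum_def fibp w_def using f by (subst sum_diff) auto
    also have "(\<Sum>u\<in>f ` ({..<j} - {p}). Y r u) = (\<Sum>b\<in>{..<j} - {p}. Y r (f b))"
      using inj by (simp add: sum.reindex)
    finally show "block_sum n Y \<phi> p r = (\<Sum>c<j. (if c = p then 1 else - 1) * g c r)"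
      using p(1) by (subst sum.remove[of _ p]) (auto simp: g_def G_def sum_negf)
  qed
  finally have "cdet j (block_sum n Y \<phi>) \<noteq> 0" using g by simp
  with phi_less show thesis using that by blast
qed

text \<open>The trace is cyclic: \<open>P * B * Q\<close> has the trace of \<open>B\<close>, whose
  diagonal is \<open>es\<close>.\<close>

lemma sum_eigenvalues_eq_trace:
  fixes L :: "real mat"
  assumes L: "L \<in> carrier_mat n n" and cp: "char_poly L = (\<Prod>a\<leftarrow>es. [:- a, 1:])"
  shows "(\<Sum>i<n. es ! i) = (\<Sum>u<n. L $$ (u, u))"
proof -
  obtain B P Q where schur: "schur_decomposition L es = (B, P, Q)"
    by (cases "schur_decomposition L es") auto
  from schur_decomposition[OF L cp schur]
  have sim: "similar_mat_wit L B P Q" and diag: "diag_mat B = es" by auto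
  from similar_mat_witD2[OF L sim]
  have QP: "Q * P = 1\<^sub>m n" and LB: "L = P * B * Q"
    and B: "B \<in> carrier_mat n n" and P: "P \<in> carrier_mat n n" and Q: "Q \<in> carrier_mat n n" by auto
  have QP': "(\<Sum>u<n. Q $$ (l, u) * P $$ (u, i)) = (if l = i then 1 else 0)" if "l < n" "i < n" for l i
  proof -
    have "(Q * P) $$ (l, i) = (if l = i then 1 else 0)" using QP that by simp
    then show ?thesis using that P Q by (simp add: scalar_prod_def atLeast0LessThan)
  qed
  have "(\<Sum>u<n. L $$ (u, u)) = (\<Sum>u<n. \<Sum>i<n. \<Sum>l<n. P $$ (u, i) * (B $$ (i, l) * Q $$ (l, u)))"
    unfolding LB assoc_mult_mat[OF P B Q]
    using P B Q by (simp add: scalar_prod_def atLeast0LessThan sum_distrib_left)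
  also have "\<dots> = (\<Sum>i<n. \<Sum>u<n. \<Sum>l<n. P $$ (u, i) * (B $$ (i, l) * Q $$ (l, u)))"
    by (rule sum.swap)
  also have "\<dots> = (\<Sum>i<n. \<Sum>l<n. \<Sum>u<n. P $$ (u, i) * (B $$ (i, l) * Q $$ (l, u)))"
    by (intro sum.cong refl sum.swap)
  also have "\<dots> = (\<Sum>i<n. \<Sum>l<n. B $$ (i, l) * (\<Sum>u<n. Q $$ (l, u) * P $$ (u, i)))"
    by (simp add: sum_distrib_left mult_ac)
  also have "\<dots> = (\<Sum>l<n. B $$ (l, l))"
    by (intro sum.cong refl) (simp add: QP' if_distrib cong: if_cong)
  also have "\<dots> = (\<Sum>i<n. es ! i)"
    using diag B by (intro sum.cong refl) (auto simp: diag_mat_def)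
  finally show ?thesis ..
qed

text \<open>Moving \<open>y\<close> from column \<open>b\<close> to column \<open>c\<close>
  preserves the sum of the two columns. With that sum in place of column \<open>c\<close>, only
  column \<open>b\<close> changes, and Cramer's rule applies.\<close>

lemma cdet_move:
  assumes bc: "b < j" "c < j" "b \<noteq> c" and y: "\<And>r. r < j \<Longrightarrow> y r = (\<Sum>d<j. l d * g d r)"
  shows "cdet j (g(b := (\<lambda>r. g b r - y r), c := (\<lambda>r. g c r + y r))) = (1 - l b + l c) * cdet j g"
proof -
  have two: "(\<Sum>d<j. x d * h d) = x b * h b + x c * h c + (\<Sum>d\<in>{..<j} - {b, c}. x d * h d)"
    for x h :: "nat \<Rightarrow> real"
    using bc by (subst sum.subset_diff[of "{b, c}"]) auto
  define N where "N = g(c := (\<lambda>r. g b r + g c r))"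
  have N: "cdet j N = 1 * cdet j g"
    unfolding N_def
    using cdet_update[OF bc(2), where x = "\<lambda>d. if d = b \<or> d = c then 1 else 0" and g = g
        and v = "\<lambda>r. g b r + g c r"] bc by (simp add: two)
  define M where "M = N(b := (\<lambda>r. g b r - y r))"
  have "cdet j M = (if b = b then 1 - l b + l c else - l b) * cdet j N"
    unfolding M_def
  \<comment> \<open>The coefficient at \<open>b\<close> gains \<open>l c\<close> because
    \<open>g c\<close> equals \<open>N c\<close> minus \<open>N b\<close>.\<close>
  proof (rule cdet_update[OF bc(1), where x = "\<lambda>d. if d = b then 1 - l b + l c else - l d"])
    fix r assume r: "r < j"
    have "y r = l b * g b r + l c * g c r + (\<Sum>d\<in>{..<j} - {b, c}. l d * g d r)"
      using y[OF r] two[of l "\<lambda>d. g d r"] by simp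
    then show "g b r - y r = (\<Sum>d<j. (if d = b then 1 - l b + l c else - l d) * N d r)"
      using bc by (simp add: two N_def sum_negf algebra_simps)
  qed
  then have M: "cdet j M = (1 - l b + l c) * cdet j N" by simp
  \<comment> \<open>Subtracting the new column \<open>b\<close> from the sum of both leaves
    \<open>g c r + y r\<close>.\<close>
  have "cdet j (M(c := (\<lambda>r. g c r + y r))) = 1 * cdet j M"
    using cdet_update[OF bc(2), where x = "\<lambda>d. if d = c then 1 else if d = b then - 1 else 0" and g = M
        and v = "\<lambda>r. g c r + y r"] bc by (simp add: two M_def N_def)
  moreover have "M(c := (\<lambda>r. g c r + y r)) = g(b := (\<lambda>r. g b r - y r), c := (\<lambda>r. g c r + y r))"
    using bc by (auto simp: M_def N_def fun_eq_iff)
  ultimately show ?thesis using M N by simp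
qed

text \<open>\<open>l\<close> holds the coordinates of the columns of \<open>Y\<close> in the basis
  of block sums. The inequality says that no move of a single vertex enlarges the determinant in
  absolute value. The trace identity is that of \<open>N T g\<close> and \<open>T\<close>, where
  \<open>N\<close> is inverse to the matrix \<open>g\<close> of block sums.\<close>

lemma maximal_partition:
  fixes L :: "nat \<Rightarrow> nat \<Rightarrow> real" and Y T Z :: "nat \<Rightarrow> nat \<Rightarrow> real"
  assumes YL: "\<And>r u. r < j \<Longrightarrow> u < n \<Longrightarrow> (\<Sum>v<n. Y r v * L v u) = (\<Sum>s<j. T r s * Y s u)"
    and YZ: "\<And>r s. r < j \<Longrightarrow> s < j \<Longrightarrow> (\<Sum>u<n. Y r u * Z u s) = (if r = s then 1 else 0)"
    and nz: "\<exists>r<j. (\<Sum>u<n. Y r u) \<noteq> 0"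
  obtains \<phi> and l :: "nat \<Rightarrow> nat \<Rightarrow> real" where
    "\<And>u. u < n \<Longrightarrow> \<phi> u < j"
    "\<And>b c. b < j \<Longrightarrow> c < j \<Longrightarrow> (\<Sum>u | u < n \<and> \<phi> u = c. l b u) = (if b = c then 1 else 0)"
    "\<And>u b. u < n \<Longrightarrow> b < j \<Longrightarrow> l b u \<le> l (\<phi> u) u"
    "(\<Sum>r<j. T r r) = (\<Sum>u<n. \<Sum>v<n. l (\<phi> u) v * L v u)"
proof -
  \<comment> \<open>Extensional functions form a finite set. As \<open>D\<close> ignores values
    outside \<open>{..<n}\<close>, restricting to them loses no partition.\<close>
  define F where "F = {..<n} \<rightarrow>\<^sub>E {..<j}"
  define D where "D \<phi> = \<bar>cdet j (block_sum n Y \<phi>)\<bar>" for \<phi>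
  have D_cong: "D \<phi> = D \<psi>" if "\<And>u. u < n \<Longrightarrow> \<phi> u = \<psi> u" for \<phi> \<psi>
    unfolding D_def block_sum_def using that
    by (intro arg_cong[of _ _ abs] cdet_cong sum.cong) auto
  obtain p where "p < j" "(\<Sum>u<n. Y p u) \<noteq> 0" using nz by blast
  from exists_partition_cdet_nonzero[OF YZ this] obtain \<phi>0 where
    phi0: "\<And>u. u < n \<Longrightarrow> \<phi>0 u < j" "D \<phi>0 \<noteq> 0" by (auto simp: D_def)
  have r0: "restrict \<phi>0 {..<n} \<in> F" "D (restrict \<phi>0 {..<n}) = D \<phi>0"
    using phi0 by (auto simp: F_def intro!: D_cong)
  have fin: "finite F" by (simp add: F_def finite_PiE)
  have "Max (D ` F) \<in> D ` F" using fin r0 by (intro Max_in) auto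
  then obtain \<phi> where phi: "\<phi> \<in> F" "D \<phi> = Max (D ` F)" by auto
  have max: "D \<psi> \<le> D \<phi>" if "\<And>u. u < n \<Longrightarrow> \<psi> u < j" for \<psi>
  proof -
    have "restrict \<psi> {..<n} \<in> F" using that by (auto simp: F_def)
    then have "D (restrict \<psi> {..<n}) \<le> D \<phi>" unfolding phi(2) using fin by (intro Max_ge) auto
    moreover have "D (restrict \<psi> {..<n}) = D \<psi>" by (rule D_cong) simp
    ultimately show ?thesis by simp
  qed
  have pos: "D \<phi> > 0" using max[OF phi0(1)] phi0(2) by (auto simp: D_def)
  have phi_less: "\<phi> u < j" if "u < n" for u using phi(1) that by (auto simp: F_def)
  define g where "g = block_sum n Y \<phi>"
  have g: "cdet j g \<noteq> 0" using pos by (auto simp: D_def g_def)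
  obtain N where N1: "\<And>r s. r < j \<Longrightarrow> s < j \<Longrightarrow> (\<Sum>c<j. g c r * N c s) = (if r = s then 1 else 0)"
    and N2: "\<And>c d. c < j \<Longrightarrow> d < j \<Longrightarrow> (\<Sum>r<j. N c r * g d r) = (if c = d then 1 else 0)"
    using cdet_inverse[OF g] by blast
  define l where "l b u = (\<Sum>s<j. N b s * Y s u)" for b u
  have coord: "Y r u = (\<Sum>c<j. l c u * g c r)" if r: "r < j" for r u
  proof -
    have "(\<Sum>c<j. l c u * g c r) = (\<Sum>s<j. (\<Sum>c<j. g c r * N c s) * Y s u)"
      unfolding l_def sum_distrib_right by (subst sum.swap) (simp add: mult_ac)
    also have "\<dots> = Y r u" using r by (simp add: N1 if_distrib if_distribR cong: if_cong)
    finally show ?thesis ..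
  qed
  show thesis
  proof (rule that[of \<phi> l])
    show "(\<Sum>u | u < n \<and> \<phi> u = c. l b u) = (if b = c then 1 else 0)" if bc: "b < j" "c < j" for b c
    proof -
      have "(\<Sum>u | u < n \<and> \<phi> u = c. l b u) = (\<Sum>s<j. N b s * g c s)"
        unfolding l_def g_def block_sum_def sum_distrib_left by (rule sum.swap)
      then show ?thesis using N2 bc by simp
    qed
  next
    fix u b assume u: "u < n" and b: "b < j"
    show "l b u \<le> l (\<phi> u) u"
    proof (cases "b = \<phi> u")
      case False
      have "cdet j (block_sum n Y (\<phi>(u := b))) =
          cdet j (g(\<phi> u := (\<lambda>r. g (\<phi> u) r - Y r u), b := (\<lambda>r. g b r + Y r u)))"
      proof (rule cdet_cong)
        fix c r
        have 1: "{w. w < n \<and> (\<phi>(u := b)) w = b} = insert u {w. w < n \<and> \<phi> w = b}" using u by auto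
        have 2: "{w. w < n \<and> (\<phi>(u := b)) w = \<phi> u} = {w. w < n \<and> \<phi> w = \<phi> u} - {u}"
          using u False by auto
        have 3: "{w. w < n \<and> (\<phi>(u := b)) w = c} = {w. w < n \<and> \<phi> w = c}" if "c \<noteq> b" "c \<noteq> \<phi> u"
          using that by auto
        have "block_sum n Y (\<phi>(u := b)) b r = g b r + Y r u"
          unfolding block_sum_def g_def 1 using False by (subst sum.insert) auto
        moreover have "block_sum n Y (\<phi>(u := b)) (\<phi> u) r = g (\<phi> u) r - Y r u"
          unfolding block_sum_def g_def 2 using u by (subst sum_diff1) auto
        moreover have "block_sum n Y (\<phi>(u := b)) c r = g c r" if "c \<noteq> b" "c \<noteq> \<phi> u"
          unfolding block_sum_def g_def 3[OF that] ..
        ultimately show "block_sum n Y (\<phi>(u := b)) c r =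
            (g(\<phi> u := (\<lambda>r. g (\<phi> u) r - Y r u), b := (\<lambda>r. g b r + Y r u))) c r" by simp
      qed
      also have "\<dots> = (1 - l (\<phi> u) u + l b u) * cdet j g"
        using False phi_less[OF u] b coord by (intro cdet_move) auto
      finally have "D (\<phi>(u := b)) = \<bar>1 - l (\<phi> u) u + l b u\<bar> * D \<phi>"
        by (simp add: D_def g_def abs_mult)
      moreover have "D (\<phi>(u := b)) \<le> D \<phi>" using phi_less b by (intro max) auto
      ultimately have "\<bar>1 - l (\<phi> u) u + l b u\<bar> \<le> 1" using pos by simp
      then show ?thesis by linarith
    qed simp
  next
    \<comment> \<open>The rows \<open>l\<close> satisfy \<open>N Y L = N T Y\<close>. Summing the
      entries of row \<open>b\<close> over block \<open>b\<close> turns \<open>Y\<close> into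
      \<open>g\<close>, so the total is the trace of \<open>N T g\<close>.\<close>
    have "(\<Sum>u<n. \<Sum>v<n. l (\<phi> u) v * L v u) = (\<Sum>u<n. \<Sum>s<j. N (\<phi> u) s * (\<Sum>v<n. Y s v * L v u))"
    proof (rule sum.cong[OF refl])
      fix u
      have "(\<Sum>v<n. l (\<phi> u) v * L v u) = (\<Sum>v<n. \<Sum>s<j. N (\<phi> u) s * (Y s v * L v u))"
        by (simp add: l_def sum_distrib_left sum_distrib_right mult_ac)
      also have "\<dots> = (\<Sum>s<j. \<Sum>v<n. N (\<phi> u) s * (Y s v * L v u))" by (rule sum.swap)
      finally show "(\<Sum>v<n. l (\<phi> u) v * L v u) = (\<Sum>s<j. N (\<phi> u) s * (\<Sum>v<n. Y s v * L v u))"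
        by (simp add: sum_distrib_left)
    qed
    also have "\<dots> = (\<Sum>u<n. \<Sum>s<j. \<Sum>t<j. N (\<phi> u) s * T s t * Y t u)"
    proof (intro sum.cong[OF refl])
      fix u s assume "u \<in> {..<n}" "s \<in> {..<j}"
      then have "(\<Sum>v<n. Y s v * L v u) = (\<Sum>t<j. T s t * Y t u)" by (simp add: YL)
      then show "N (\<phi> u) s * (\<Sum>v<n. Y s v * L v u) = (\<Sum>t<j. N (\<phi> u) s * T s t * Y t u)"
        by (simp add: sum_distrib_left mult.assoc)
    qed
    also have "\<dots> = (\<Sum>b<j. \<Sum>u | u < n \<and> \<phi> u = b. \<Sum>s<j. \<Sum>t<j. N (\<phi> u) s * T s t * Y t u)"
      using phi_less by (subst sum.group[symmetric, of "{..<n}" "{..<j}" \<phi>]) auto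
    also have "\<dots> = (\<Sum>b<j. \<Sum>s<j. \<Sum>t<j. T s t * (g b t * N b s))"
    proof (rule sum.cong[OF refl])
      fix b
      have "(\<Sum>u | u < n \<and> \<phi> u = b. \<Sum>s<j. \<Sum>t<j. N (\<phi> u) s * T s t * Y t u) =
          (\<Sum>u | u < n \<and> \<phi> u = b. \<Sum>s<j. \<Sum>t<j. N b s * T s t * Y t u)"
        by (intro sum.cong) auto
      also have "\<dots> = (\<Sum>s<j. \<Sum>u | u < n \<and> \<phi> u = b. \<Sum>t<j. N b s * T s t * Y t u)"
        by (rule sum.swap)
      also have "\<dots> = (\<Sum>s<j. \<Sum>t<j. \<Sum>u | u < n \<and> \<phi> u = b. N b s * T s t * Y t u)"
        by (intro sum.cong refl sum.swap)
      finally show "(\<Sum>u | u < n \<and> \<phi> u = b. \<Sum>s<j. \<Sum>t<j. N (\<phi> u) s * T s t * Y t u) =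
          (\<Sum>s<j. \<Sum>t<j. T s t * (g b t * N b s))"
        by (simp add: g_def block_sum_def sum_distrib_left sum_distrib_right mult_ac)
    qed
    also have "\<dots> = (\<Sum>s<j. \<Sum>b<j. \<Sum>t<j. T s t * (g b t * N b s))" by (rule sum.swap)
    also have "\<dots> = (\<Sum>s<j. \<Sum>t<j. \<Sum>b<j. T s t * (g b t * N b s))"
      by (intro sum.cong refl sum.swap)
    also have "\<dots> = (\<Sum>s<j. \<Sum>t<j. T s t * (\<Sum>b<j. g b t * N b s))"
      by (simp add: sum_distrib_left)
    also have "\<dots> = (\<Sum>s<j. T s s)"
      by (intro sum.cong refl) (simp add: N1 if_distrib cong: if_cong)
    finally show "(\<Sum>r<j. T r r) = (\<Sum>u<n. \<Sum>v<n. l (\<phi> u) v * L v u)" ..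
  qed (use phi_less in auto)
qed

section \<open>The Laplacian through sums over ordered pairs of adjacent vertices\<close>

definition arcs :: "'a set set \<Rightarrow> ('a \<times> 'a) set" where
  "arcs E = {(u, v). {u, v} \<in> E}"

lemma arcs_subset:
  assumes "simple_graph V E"
  shows "arcs E \<subseteq> {(u, v). u \<in> V \<and> v \<in> V \<and> u \<noteq> v}"
  using assms by (fastforce simp: arcs_def simple_graph_def)

lemma finite_arcs:
  assumes "simple_graph V E"
  shows "finite (arcs E)"
proof (rule finite_subset)
  show "arcs E \<subseteq> V \<times> V" using arcs_subset[OF assms] by auto
  show "finite (V \<times> V)" using assms by (simp add: simple_graph_def)
qed

lemma vdegree_eq_card_neighbours:
  assumes "simple_graph V E" "u \<in> V"
  shows "vdegree E u = card {v \<in> V. {u, v} \<in> E}"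
proof -
  have "bij_betw (\<lambda>v. {u, v}) {v \<in> V. {u, v} \<in> E} {e \<in> E. u \<in> e}"
  proof (rule bij_betwI')
    fix e assume "e \<in> {e \<in> E. u \<in> e}"
    then have e: "e \<in> E" "u \<in> e" "card e = 2" "e \<subseteq> V" using assms by (auto simp: simple_graph_def)
    then obtain v where "e = {u, v}" by (auto simp: card_2_iff)
    with e show "\<exists>v\<in>{v \<in> V. {u, v} \<in> E}. e = {u, v}" by auto
  next
    fix v w assume "v \<in> {v \<in> V. {u, v} \<in> E}" "w \<in> {v \<in> V. {u, v} \<in> E}"
    then show "({u, v} = {u, w}) = (v = w)" by (auto simp: doubleton_eq_iff)
  qed auto
  then show ?thesis unfolding vdegree_def by (simp add: bij_betw_same_card)
qed

lemma sum_arcs: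
  assumes "simple_graph V E"
  shows "(\<Sum>(u, v)\<in>arcs E. f u v) = (\<Sum>u\<in>V. \<Sum>v | v \<in> V \<and> {u, v} \<in> E. f u v)"
proof -
  have "arcs E = Sigma V (\<lambda>u. {v \<in> V. {u, v} \<in> E})" using arcs_subset[OF assms] by (auto simp: arcs_def)
  then show ?thesis using assms by (simp add: sum.Sigma simple_graph_def)
qed

text \<open>The degree on the diagonal supplies one copy of \<open>f u\<close> for each neighbour
  \<open>v\<close>, to be paired with the off-diagonal term \<open>- f v\<close>.\<close>

lemma sum_laplacian_entry:
  assumes G: "simple_graph V E" and u: "u \<in> V"
  shows "(\<Sum>v\<in>V. f v * laplacian_entry E v u) = (\<Sum>v | v \<in> V \<and> {u, v} \<in> E. f u - f v)"
proof -
  have fin: "finite V" using G by (simp add: simple_graph_def)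
  have "{u} \<notin> E" using G by (auto simp: simple_graph_def)
  then have "(\<Sum>v\<in>V - {u}. f v * laplacian_entry E v u) = (\<Sum>v\<in>{v \<in> V. {u, v} \<in> E}. - f v)"
    using fin by (intro sum.mono_neutral_cong_right) (auto simp: laplacian_entry_def insert_commute)
  then have "(\<Sum>v\<in>V. f v * laplacian_entry E v u) =
      f u * real (vdegree E u) + (\<Sum>v | v \<in> V \<and> {u, v} \<in> E. - f v)"
    using fin u by (simp add: sum.remove[of _ u] laplacian_entry_def)
  then show ?thesis
    by (simp add: vdegree_eq_card_neighbours[OF G u] sum_subtractf sum_negf)
qed

lemma card_arcs:
  assumes "simple_graph V E"
  shows "card (arcs E) = 2 * card E"
proof -
  have E: "finite E" using assms
    by (meson Pow_iff finite_Pow_iff finite_subset simple_graph_def subsetI)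
  have two: "card {a \<in> arcs E. (case a of (u, v) \<Rightarrow> {u, v}) = e} = 2" if e: "e \<in> E" for e
  proof -
    obtain x y where xy: "e = {x, y}" "x \<noteq> y"
      using e assms by (auto simp: simple_graph_def card_2_iff)
    then have "{a \<in> arcs E. (case a of (u, v) \<Rightarrow> {u, v}) = e} = {(x, y), (y, x)}"
      using e by (auto simp: arcs_def doubleton_eq_iff insert_commute)
    with xy show ?thesis by simp
  qed
  have "card (arcs E) = (\<Sum>e\<in>E. card {a \<in> arcs E. (case a of (u, v) \<Rightarrow> {u, v}) = e})"
    using sum.group[OF finite_arcs[OF assms] E, of "\<lambda>(u, v). {u, v}" "\<lambda>_. 1::nat"]
    by (force simp: arcs_def)
  then show ?thesis using two by simp
qed

lemma sum_arcs_swap: "(\<Sum>(u, v)\<in>arcs E. f u v) = (\<Sum>(u, v)\<in>arcs E. f v u)"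
  by (rule sum.reindex_bij_witness[of _ prod.swap prod.swap])
    (auto simp: arcs_def insert_commute)

text \<open>The list is non-increasing and a Schur decomposition keeps the order of the factors, so
  the diagonal positions from \<open>k\<close> on carry the smallest eigenvalues.\<close>

lemma char_poly_laplacian_eq_prod:
  assumes "simple_graph V E"
  shows "char_poly (laplacian V E) = (\<Prod>a\<leftarrow>laplacian_eigenvalues V E. [:- a, 1:])"
proof -
  have L: "laplacian V E \<in> carrier_mat (card V) (card V)"
    using assms vertex_list(3)[of V] by (simp add: laplacian_def laplacian_list_def simple_graph_def)
  have "size (proots (char_poly (laplacian V E))) = card V"
    using length_laplacian_eigenvalues[OF assms] unfolding laplacian_eigenvalues_def
    by (metis length_rev mset_sorted_list_of_multiset size_mset)
  with degree_monic_char_poly[OF L]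
  have "char_poly (laplacian V E) = (\<Prod>x\<in>#proots (char_poly (laplacian V E)). [:- x, 1:])"
    by (intro monic_eq_prod_proots) auto
  also have "\<dots> = (\<Prod>x\<in>#mset (laplacian_eigenvalues V E). [:- x, 1:])"
    by (simp add: laplacian_eigenvalues_def)
  also have "\<dots> = (\<Prod>a\<leftarrow>laplacian_eigenvalues V E. [:- a, 1:])"
    by (metis mset_map prod_mset_prod_list)
  finally show ?thesis .
qed

section \<open>Weights of pairs of vertices\<close>

text \<open>In the notation of the introductory comment, \<open>z u b\<close> is \<open>1 - x\<^sub>u\<close> for the move of \<open>u\<close> to
  block \<open>b\<close>.\<close>
locale block_weights =
  fixes V :: "'a set" and j :: nat and \<phi> :: "'a \<Rightarrow> nat" and z :: "'a \<Rightarrow> nat \<Rightarrow> real"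
  assumes finite: "finite V"
    and block_less: "u \<in> V \<Longrightarrow> \<phi> u < j"
    and block_nonempty: "b < j \<Longrightarrow> \<exists>u\<in>V. \<phi> u = b"
    and weight_nonneg: "u \<in> V \<Longrightarrow> b < j \<Longrightarrow> 0 \<le> z u b"
    and weight_le_1: "u \<in> V \<Longrightarrow> b < j \<Longrightarrow> z u b \<le> 1"
    and weight_own: "u \<in> V \<Longrightarrow> z u (\<phi> u) = 1"
    and weight_sum: "b < j \<Longrightarrow> c < j \<Longrightarrow> b \<noteq> c \<Longrightarrow>
      (\<Sum>u | u \<in> V \<and> \<phi> u = b. z u c) = real (card {u \<in> V. \<phi> u = b}) - 1"

text \<open>\<open>j\<close> can exceed \<open>card V - k\<close> because the all-ones row may have
  been adjoined. The factor 2 is there because each edge gives two arcs.\<close>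

theorem laplacian_sum_block_bound:
  assumes G: "simple_graph V E" and V: "V \<noteq> {}" and k: "k \<le> card V"
  obtains j \<phi> z where "block_weights V j \<phi> z" "card V \<le> j + k"
    "2 * laplacian_sum V E k \<le> (\<Sum>(u, v)\<in>arcs E. 1 + z u (\<phi> v) * z v (\<phi> u))"
proof -
  have fin: "finite V" using G by (simp add: simple_graph_def)
  define n where "n = card V"
  define vs where "vs = vertex_list V"
  define es where "es = laplacian_eigenvalues V E"
  define L where "L = laplacian V E"
  have vs: "distinct vs" "set vs = V" "length vs = n"
    using vertex_list[OF fin] by (auto simp: vs_def n_def)
  have n: "0 < n" using fin V by (auto simp: n_def card_gt_0_iff)
  have L: "L \<in> carrier_mat n n"
    by (simp add: L_def laplacian_def laplacian_list_def vs(3) flip: vs_def)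
  have entry: "L $$ (v, u) = laplacian_entry E (vs ! v) (vs ! u)" if "v < n" "u < n" for u v
    using that by (simp add: L_def laplacian_def laplacian_list_def vs(3) flip: vs_def)
  have bij: "bij_betw ((!) vs) {..<n} V" using vs by (intro bij_betw_nth) auto
  define idx where "idx = the_inv_into {..<n} ((!) vs)"
  have idx: "idx (vs ! u) = u" if "u < n" for u
    using that bij by (simp add: idx_def the_inv_into_f_f bij_betw_def)
  have idx_less: "idx x < n" and nth_idx: "vs ! idx x = x" if "x \<in> V" for x
  proof -
    have "x \<in> (!) vs ` {..<n}" using that bij by (simp add: bij_betw_def)
    then obtain u where "u < n" "x = vs ! u" by auto
    then show "idx x < n" "vs ! idx x = x" using idx by auto
  qed
  have reindex: "(\<Sum>u<n. f (vs ! u)) = (\<Sum>x\<in>V. f x)" for f :: "'a \<Rightarrow> real"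
    using sum.reindex_bij_betw[OF bij] .
  have cp: "char_poly L = (\<Prod>a\<leftarrow>es. [:- a, 1:])"
    unfolding L_def es_def by (rule char_poly_laplacian_eq_prod[OF G])
  have lower: "(\<Sum>v<n. f v * L $$ (v, u)) =
      (\<Sum>y | y \<in> V \<and> {vs ! u, y} \<in> E. f u - f (idx y))" if u: "u < n" for f u
  proof -
    have "(\<Sum>v<n. f v * L $$ (v, u)) = (\<Sum>v<n. f (idx (vs ! v)) * laplacian_entry E (vs ! v) (vs ! u))"
      using u by (intro sum.cong) (auto simp: entry idx)
    also have "\<dots> = (\<Sum>y\<in>V. f (idx y) * laplacian_entry E y (vs ! u))" by (rule reindex)
    also have "\<dots> = (\<Sum>y | y \<in> V \<and> {vs ! u, y} \<in> E. f (idx (vs ! u)) - f (idx y))"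
      using u bij by (intro sum_laplacian_entry[OF G]) (auto simp: bij_betw_def)
    finally show ?thesis using idx u by simp
  qed
  have col: "(\<Sum>v<n. L $$ (v, u)) = 0" if "u < n" for u using lower[OF that, of "\<lambda>_. 1"] by simp
  obtain Y T Z where YL: "\<And>r u. r < n - k \<Longrightarrow> u < n \<Longrightarrow>
      (\<Sum>v<n. Y r v * L $$ (v, u)) = (\<Sum>s<n - k. T r s * Y s u)"
    and tr: "(\<Sum>r<n - k. T r r) = (\<Sum>i=k..<n. es ! i)"
    and YZ: "\<And>r s. r < n - k \<Longrightarrow> s < n - k \<Longrightarrow> (\<Sum>u<n. Y r u * Z u s) = (if r = s then 1 else 0)"
    using lower_invariant_rows[OF L cp k[folded n_def]] by blast
  obtain j Y' T' Z' where j: "n - k \<le> j"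
    and YL': "\<And>r u. r < j \<Longrightarrow> u < n \<Longrightarrow> (\<Sum>v<n. Y' r v * L $$ (v, u)) = (\<Sum>s<j. T' r s * Y' s u)"
    and YZ': "\<And>r s. r < j \<Longrightarrow> s < j \<Longrightarrow> (\<Sum>u<n. Y' r u * Z' u s) = (if r = s then 1 else 0)"
    and tr': "(\<Sum>r<j. T' r r) = (\<Sum>r<n - k. T r r)" and nz: "\<exists>r<j. (\<Sum>u<n. Y' r u) \<noteq> 0"
    using invariant_rows_not_balanced[where L = "\<lambda>v u. L $$ (v, u)", OF YL YZ col n] by blast
  obtain \<phi> l where phi: "\<And>u. u < n \<Longrightarrow> \<phi> u < j"
    and l_sum: "\<And>b c. b < j \<Longrightarrow> c < j \<Longrightarrow>
      (\<Sum>u | u < n \<and> \<phi> u = c. l b u) = (if b = c then 1 else 0)"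
    and l_le: "\<And>u b. u < n \<Longrightarrow> b < j \<Longrightarrow> l b u \<le> l (\<phi> u) u"
    and l_tr: "(\<Sum>r<j. T' r r) = (\<Sum>u<n. \<Sum>v<n. l (\<phi> u) v * L $$ (v, u))"
    using maximal_partition[where L = "\<lambda>v u. L $$ (v, u)", OF YL' YZ' nz] by blast
  \<comment> \<open>The partition and the coordinates, carried over from list positions to
    vertices.\<close>
  define \<psi> where "\<psi> x = \<phi> (idx x)" for x
  define m where "m b x = l b (idx x)" for b x
  define z where "z x b = 1 - (m (\<psi> x) x - m b x)" for x b
  have psi: "\<psi> x < j" if "x \<in> V" for x using phi idx_less that by (simp add: \<psi>_def)
  have m_sum: "(\<Sum>x | x \<in> V \<and> \<psi> x = c. m b x) = (if b = c then 1 else 0)" if "b < j" "c < j" for b c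
  proof -
    have "(\<Sum>x | x \<in> V \<and> \<psi> x = c. m b x) = (\<Sum>u | u < n \<and> \<phi> u = c. l b u)"
      using bij idx_less nth_idx idx
      by (intro sum.reindex_bij_witness[of _ "(!) vs" idx]) (auto simp: \<psi>_def m_def bij_betw_def)
    then show ?thesis using l_sum that by simp
  qed
  have m_le: "m b x \<le> m (\<psi> x) x" if "x \<in> V" "b < j" for x b
    using l_le idx_less that by (simp add: m_def \<psi>_def)
  have diff_sum: "(\<Sum>x | x \<in> V \<and> \<psi> x = b. m (\<psi> x) x - m c x) = 1"
    if "b < j" "c < j" "b \<noteq> c" for b c
  proof -
    have "(\<Sum>x | x \<in> V \<and> \<psi> x = b. m (\<psi> x) x - m c x) = (\<Sum>x | x \<in> V \<and> \<psi> x = b. m b x - m c x)"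
      by (intro sum.cong) auto
    then show ?thesis using m_sum that by (simp add: sum_subtractf)
  qed
  have nonneg: "0 \<le> z x b" if x: "x \<in> V" and b: "b < j" for x b
  proof (cases "b = \<psi> x")
    case False
    have le: "m b y \<le> m (\<psi> x) y" if "y \<in> V" "\<psi> y = \<psi> x" for y
      using m_le[OF that(1) b] that(2) by simp
    \<comment> \<open>Within a block these differences are nonnegative and sum to 1, so none exceeds
      1.\<close>
    have "m (\<psi> x) x - m b x \<le> (\<Sum>y | y \<in> V \<and> \<psi> y = \<psi> x. m (\<psi> y) y - m b y)"
      using x le fin
      by (intro member_le_sum[of x _ "\<lambda>y. m (\<psi> y) y - m b y"]) auto
    also have "\<dots> = 1" using False psi x b by (intro diff_sum) auto
    finally show ?thesis by (simp add: z_def)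
  qed (simp add: z_def)
  show thesis
  proof (rule that[of j \<psi> z])
    show "block_weights V j \<psi> z"
    proof
      fix b assume b: "b < j"
      \<comment> \<open>Over an empty block the sum of \<open>m b\<close> would be 0, but it is
        1.\<close>
      have "{x. x \<in> V \<and> \<psi> x = b} \<noteq> {}"
      proof
        assume *: "{x. x \<in> V \<and> \<psi> x = b} = {}"
        show False using m_sum[OF b b] unfolding * by simp
      qed
      then show "\<exists>x\<in>V. \<psi> x = b" by auto
    next
      fix b c assume "b < j" "c < j" "b \<noteq> c"
      from diff_sum[OF this]
      show "(\<Sum>x | x \<in> V \<and> \<psi> x = b. z x c) = real (card {x \<in> V. \<psi> x = b}) - 1"
        by (simp add: z_def sum_subtractf)
    qed (use fin psi nonneg m_le in \<open>auto simp: z_def\<close>)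
    show "card V \<le> j + k" using j by (simp add: n_def)
    have es_sum: "laplacian_sum V E k = (\<Sum>i<k. es ! i)"
      unfolding laplacian_sum_def laplacian_eigenvalue_def es_def
      by (rule sum.reindex_bij_witness[of _ Suc "\<lambda>i. i - 1"]) auto
    have split: "(\<Sum>i<n. es ! i) = (\<Sum>i<k. es ! i) + (\<Sum>i=k..<n. es ! i)"
      using k sum.atLeastLessThan_concat[of 0 k n "\<lambda>i. es ! i"] by (simp add: n_def atLeast0LessThan)
    have total: "(\<Sum>i<n. es ! i) = (\<Sum>(x, y)\<in>arcs E. 1)"
    proof -
      have "(\<Sum>i<n. es ! i) = (\<Sum>u<n. L $$ (u, u))" by (rule sum_eigenvalues_eq_trace[OF L cp])
      also have "\<dots> = (\<Sum>u<n. real (vdegree E (vs ! u)))"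
        by (intro sum.cong) (auto simp: entry laplacian_entry_def)
      also have "\<dots> = (\<Sum>x\<in>V. real (vdegree E x))" by (rule reindex)
      also have "\<dots> = (\<Sum>x\<in>V. \<Sum>y | y \<in> V \<and> {x, y} \<in> E. 1)"
        by (intro sum.cong refl) (simp add: vdegree_eq_card_neighbours[OF G])
      finally show ?thesis by (simp only: sum_arcs[OF G])
    qed
    \<comment> \<open>Reversing all arcs expresses \<open>S\<close> through the differences at the
      other end; the sum of both forms is symmetric in the two ends.\<close>
    define S where "S = (\<Sum>(x, y)\<in>arcs E. m (\<psi> x) x - m (\<psi> x) y)"
    have "(\<Sum>i=k..<n. es ! i) = (\<Sum>u<n. \<Sum>v<n. l (\<phi> u) v * L $$ (v, u))"
      using tr tr' l_tr by simp
    also have "\<dots> = (\<Sum>u<n. \<Sum>y | y \<in> V \<and> {vs ! u, y} \<in> E. m (\<psi> (vs ! u)) (vs ! u) - m (\<psi> (vs ! u)) y)"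
      by (intro sum.cong[OF refl]) (simp add: lower m_def \<psi>_def idx)
    also have "\<dots> = (\<Sum>x\<in>V. \<Sum>y | y \<in> V \<and> {x, y} \<in> E. m (\<psi> x) x - m (\<psi> x) y)"
      by (rule reindex)
    finally have S: "(\<Sum>i=k..<n. es ! i) = S" unfolding S_def sum_arcs[OF G] .
    have S': "S = (\<Sum>(x, y)\<in>arcs E. m (\<psi> y) y - m (\<psi> y) x)"
      unfolding S_def by (rule sum_arcs_swap)
    have "2 * laplacian_sum V E k = 2 * (\<Sum>(x, y)\<in>arcs E. 1) - (S + S)"
      using es_sum split total S by simp
    also have "S + S = (\<Sum>a\<in>arcs E. (case a of (x, y) \<Rightarrow> m (\<psi> x) x - m (\<psi> x) y) +
        (case a of (x, y) \<Rightarrow> m (\<psi> y) y - m (\<psi> y) x))"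
      unfolding sum.distrib by (simp only: flip: S_def S')
    also have "2 * (\<Sum>(x, y)\<in>arcs E. 1) - \<dots> = (\<Sum>(x, y)\<in>arcs E. z x (\<psi> y) + z y (\<psi> x))"
      unfolding sum_distrib_left sum_subtractf[symmetric] by (intro sum.cong) (auto simp: z_def)
    also have "\<dots> \<le> (\<Sum>(x, y)\<in>arcs E. 1 + z x (\<psi> y) * z y (\<psi> x))"
    proof (rule sum_mono, clarify)
      fix x y assume "(x, y) \<in> arcs E"
      then have "x \<in> V" "y \<in> V" using arcs_subset[OF G] by auto
      \<comment> \<open>Expanding this product turns the sum of weights into their product. For ends
        in one block both factors are 0, so nothing is lost there.\<close>
      then have "0 \<le> (1 - z x (\<psi> y)) * (1 - z y (\<psi> x))"
        using m_le psi by (intro mult_nonneg_nonneg) (auto simp: z_def)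
      then show "z x (\<psi> y) + z y (\<psi> x) \<le> 1 + z x (\<psi> y) * z y (\<psi> x)" by (simp add: algebra_simps)
    qed
    finally show "2 * laplacian_sum V E k \<le> (\<Sum>(x, y)\<in>arcs E. 1 + z x (\<psi> y) * z y (\<psi> x))" .
  qed
qed

section \<open>Total weights of pairs in vertex sets\<close>

context block_weights
begin

text \<open>By \<open>weight_own\<close> the value is 1 for two vertices of one block, in particular
  for \<open>u = v\<close>.\<close>

definition pair_weight :: "'a \<Rightarrow> 'a \<Rightarrow> real" where "pair_weight u v = z u (\<phi> v) * z v (\<phi> u)"

abbreviation block :: "nat \<Rightarrow> 'a set" where "block b \<equiv> {u \<in> V. \<phi> u = b}"

lemma finite_block [simp]: "finite (block b)" using finite by simp

lemma pair_weight_nonneg: "u \<in> V \<Longrightarrow> v \<in> V \<Longrightarrow> 0 \<le> pair_weight u v"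
  by (simp add: pair_weight_def weight_nonneg block_less)

lemma pair_weight_le_1: "u \<in> V \<Longrightarrow> v \<in> V \<Longrightarrow> pair_weight u v \<le> 1"
  unfolding pair_weight_def by (intro mult_le_one weight_nonneg weight_le_1 block_less)

lemma pair_weight_commute: "pair_weight u v = pair_weight v u" by (simp add: pair_weight_def)

lemma block_card_ge_1: "b < j \<Longrightarrow> 1 \<le> real (card (block b))"
  using block_nonempty[of b] by (auto simp: Suc_le_eq card_gt_0_iff)

lemma own_sum:
  assumes "A \<subseteq> block b"
  shows "(\<Sum>u\<in>A. z u b) = real (card A)"
proof -
  have "(\<Sum>u\<in>A. z u b) = (\<Sum>u\<in>A. 1)" using assms weight_own by (intro sum.cong) auto
  then show ?thesis by simp
qed

lemma sum_blocks: "U \<subseteq> V \<Longrightarrow> (\<Sum>u\<in>U. f u) = (\<Sum>b<j. \<Sum>u\<in>{u \<in> U. \<phi> u = b}. f u)" for f :: "'a \<Rightarrow> real"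
  using block_less finite by (subst sum.group[symmetric, of U "{..<j}" \<phi>]) (auto intro: finite_subset)

lemma sum_block_excess: "(\<Sum>b<j. real (card (block b)) - 1) = real (card V) - real j"
  using sum_blocks[of V "\<lambda>_. 1"] by (simp add: sum_subtractf)

lemma j_le_card: "j \<le> card V"
proof -
  have "0 \<le> (\<Sum>b<j. real (card (block b)) - 1)"
    by (intro sum_nonneg) (use block_card_ge_1 in auto)
  then show ?thesis by (simp add: sum_block_excess)
qed

text \<open>Once the blocks \<open>b\<close> and \<open>c\<close> of the two ends are fixed, the
  weight is a function of \<open>u\<close> times a function of \<open>v\<close>.\<close>

lemma pair_sum:
  assumes U: "U \<subseteq> V"
  shows "(\<Sum>u\<in>U. \<Sum>v\<in>U. pair_weight u v) =
    (\<Sum>b<j. \<Sum>c<j. (\<Sum>u\<in>{u \<in> U. \<phi> u = b}. z u c) * (\<Sum>v\<in>{v \<in> U. \<phi> v = c}. z v b))"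
proof -
  have "(\<Sum>u\<in>U. \<Sum>v\<in>U. pair_weight u v) =
      (\<Sum>b<j. \<Sum>u\<in>{u \<in> U. \<phi> u = b}. \<Sum>c<j. \<Sum>v\<in>{v \<in> U. \<phi> v = c}. pair_weight u v)"
    by (simp only: sum_blocks[OF U])
  also have "\<dots> = (\<Sum>b<j. \<Sum>c<j. \<Sum>u\<in>{u \<in> U. \<phi> u = b}. \<Sum>v\<in>{v \<in> U. \<phi> v = c}. pair_weight u v)"
    by (intro sum.cong refl sum.swap)
  also have "\<dots> = (\<Sum>b<j. \<Sum>c<j. \<Sum>u\<in>{u \<in> U. \<phi> u = b}. \<Sum>v\<in>{v \<in> U. \<phi> v = c}. z u c * z v b)"
    by (intro sum.cong refl) (auto simp: pair_weight_def)
  finally show ?thesis by (simp add: sum_product)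
qed

text \<open>Another block contributes at most its size minus 1, the block of \<open>c\<close> its
  full size. The extra 1 is the weight of \<open>c\<close> with itself, which is left out.\<close>

lemma star_sum:
  assumes c: "c \<in> V"
  shows "(\<Sum>v\<in>V - {c}. pair_weight c v) \<le> real (card V) - real j"
proof -
  have "(\<Sum>v\<in>V. pair_weight c v) = (\<Sum>b<j. \<Sum>v\<in>block b. z c b * z v (\<phi> c))"
    unfolding sum_blocks[OF order_refl] by (intro sum.cong refl) (auto simp: pair_weight_def)
  also have "\<dots> = (\<Sum>b<j. z c b * (\<Sum>v\<in>block b. z v (\<phi> c)))" by (simp add: sum_distrib_left)
  also have "\<dots> \<le> (\<Sum>b<j. real (card (block b)) - 1 + (if b = \<phi> c then 1 else 0))"
  proof (rule sum_mono)
    fix b assume "b \<in> {..<j}"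
    then have b: "b < j" by simp
    show "z c b * (\<Sum>v\<in>block b. z v (\<phi> c)) \<le> real (card (block b)) - 1 + (if b = \<phi> c then 1 else 0)"
    proof (cases "b = \<phi> c")
      case True
      then show ?thesis using c by (simp add: weight_own own_sum)
    next
      case False
      then show ?thesis using weight_sum[OF b block_less[OF c]] weight_le_1[OF c b] block_card_ge_1[OF b]
        by (simp add: mult_left_le_one_le weight_nonneg[OF c b])
    qed
  qed
  also have "\<dots> = real (card V) - real j + 1"
    using block_less[OF c] by (simp add: sum.distrib sum_block_excess)
  finally have "(\<Sum>v\<in>V. pair_weight c v) \<le> real (card V) - real j + 1" .
  moreover have "(\<Sum>v\<in>V. pair_weight c v) = 1 + (\<Sum>v\<in>V - {c}. pair_weight c v)"
    using c finite by (simp add: sum.remove[of _ c] pair_weight_def weight_own)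
  ultimately show ?thesis by simp
qed

text \<open>Put \<open>K = card V - j\<close>. The products of block sizes minus 1 sum to
  \<open>K^2\<close>; a block of size \<open>s\<close> paired with itself adds
  \<open>s^2 - (s - 1)^2 = 2 s - 1\<close>, in total \<open>K + card V\<close>. The pairs
  \<open>u = v\<close> account for \<open>card V\<close>, so unordered pairs of distinct vertices
  weigh \<open>K (K + 1) / 2\<close>.\<close>

lemma total_sum: "(\<Sum>u\<in>V. \<Sum>v\<in>V. pair_weight u v) = (real (card V) - real j)\<^sup>2 + (real (card V) - real j) + real (card V)"
proof -
  let ?s = "\<lambda>b. real (card (block b))"
  have own: "(\<Sum>u\<in>block b. z u b) = ?s b" for b
    by (rule own_sum) auto
  have "(\<Sum>u\<in>V. \<Sum>v\<in>V. pair_weight u v) =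
      (\<Sum>b<j. \<Sum>c<j. (?s b - 1) * (?s c - 1) + (if b = c then 2 * ?s b - 1 else 0))"
    unfolding pair_sum[OF order_refl]
  proof (intro sum.cong refl)
    fix b c assume "b \<in> {..<j}" "c \<in> {..<j}"
    then have bc: "b < j" "c < j" by auto
    show "(\<Sum>u\<in>block b. z u c) * (\<Sum>v\<in>block c. z v b) =
        (?s b - 1) * (?s c - 1) + (if b = c then 2 * ?s b - 1 else 0)"
    proof (cases "b = c")
      case True
      then show ?thesis by (simp add: own algebra_simps)
    next
      case False
      then show ?thesis by (simp only: weight_sum[OF bc False] weight_sum[OF bc(2,1) False[symmetric]]) simp
    qed
  qed
  also have "\<dots> = (\<Sum>b<j. ?s b - 1) * (\<Sum>c<j. ?s c - 1) + (\<Sum>b<j. 2 * ?s b - 1)"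
    by (simp add: sum.distrib sum_product)
  also have "(\<Sum>b<j. 2 * ?s b - 1) = (real (card V) - real j) + real (card V)"
    using sum_block_excess by (simp add: sum_subtractf flip: sum_distrib_left)
  finally show ?thesis by (simp add: sum_block_excess power2_eq_square)
qed

text \<open>Deleting a vertex lowers a weight sum of its block by at most 1. Hence a block with
  \<open>n\<close> vertices left outside \<open>C\<close> keeps weight sum at least
  \<open>max 0 (n - 1)\<close> towards any other block; \<open>\<rho>\<close> is the sum of these
  bounds.\<close>

lemma remaining_sum:
  assumes C: "C \<subseteq> V"
  shows "\<exists>\<rho>\<ge>0. real (card V) - real j - real (card C) \<le> \<rho> \<and>
    \<rho>\<^sup>2 + \<rho> + real (card (V - C)) \<le> (\<Sum>u\<in>V - C. \<Sum>v\<in>V - C. pair_weight u v)"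
proof -
  let ?B = "\<lambda>b. {u \<in> V - C. \<phi> u = b}"
  let ?n = "\<lambda>b. real (card (?B b))"
  let ?r = "\<lambda>b. max 0 (?n b - 1)"
  have own: "(\<Sum>u\<in>?B b. z u b) = ?n b" for b
    by (rule own_sum) auto
  have part: "?r b \<le> (\<Sum>u\<in>?B b. z u c)" if bc: "b < j" "c < j" "b \<noteq> c" for b c
  proof -
    have "block b = ?B b \<union> {u \<in> C. \<phi> u = b}" using C by auto
    moreover have fin: "finite {u \<in> C. \<phi> u = b}" using C finite by (auto intro: finite_subset)
    ultimately have "(\<Sum>u\<in>block b. z u c) = (\<Sum>u\<in>?B b. z u c) + (\<Sum>u\<in>{u \<in> C. \<phi> u = b}. z u c)"
      and "card (block b) = card (?B b) + card {u \<in> C. \<phi> u = b}"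
      using finite by (simp_all only:) (subst sum.union_disjoint card_Un_disjoint; auto)+
    moreover have "(\<Sum>u\<in>{u \<in> C. \<phi> u = b}. z u c) \<le> (\<Sum>u\<in>{u \<in> C. \<phi> u = b}. 1)"
      using C bc by (intro sum_mono weight_le_1) auto
    moreover have "0 \<le> (\<Sum>u\<in>?B b. z u c)" using bc by (intro sum_nonneg weight_nonneg) auto
    ultimately show ?thesis using weight_sum[OF bc] by simp
  qed
  have "(\<Sum>b<j. ?r b)\<^sup>2 + (\<Sum>b<j. ?r b) + real (card (V - C)) =
      (\<Sum>b<j. \<Sum>c<j. ?r b * ?r c) + (\<Sum>b<j. ?r b + ?n b)"
    using sum_blocks[of "V - C" "\<lambda>_. 1"] by (simp add: sum.distrib power2_eq_square sum_product)
  also have "\<dots> = (\<Sum>b<j. \<Sum>c<j. ?r b * ?r c + (if b = c then ?r b + ?n b else 0))"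
    by (simp add: sum.distrib)
  also have "\<dots> \<le> (\<Sum>u\<in>V - C. \<Sum>v\<in>V - C. pair_weight u v)"
    unfolding pair_sum[OF Diff_subset]
  proof (intro sum_mono)
    fix b c assume "b \<in> {..<j}" "c \<in> {..<j}"
    then have bc: "b < j" "c < j" by auto
    show "?r b * ?r c + (if b = c then ?r b + ?n b else 0) \<le> (\<Sum>u\<in>?B b. z u c) * (\<Sum>v\<in>?B c. z v b)"
    proof (cases "b = c")
      case True
      \<comment> \<open>For \<open>n >= 1\<close> one has
        \<open>n^2 = (n - 1)^2 + (n - 1) + n\<close>; for \<open>n = 0\<close> both sides are
        0.\<close>
      have "?n b = 0 \<or> 1 \<le> ?n b" by (cases "card (?B b)") auto
      then show ?thesis using True own[of b] by (auto simp: max_def algebra_simps)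
    next
      case False
      then show ?thesis using part[OF bc] part[OF bc(2,1)] by (auto intro!: mult_mono)
    qed
  qed
  finally have "(\<Sum>b<j. ?r b)\<^sup>2 + (\<Sum>b<j. ?r b) + real (card (V - C)) \<le> (\<Sum>u\<in>V - C. \<Sum>v\<in>V - C. pair_weight u v)" .
  moreover have "real (card V) - real j - real (card C) \<le> (\<Sum>b<j. ?r b)"
  proof -
    have "real (card V) - real (card C) = real (card (V - C))"
      using C finite by (simp add: card_Diff_subset finite_subset card_mono of_nat_diff)
    also have "\<dots> = (\<Sum>b<j. ?n b)" using sum_blocks[of "V - C" "\<lambda>_. 1"] by simp
    also have "\<dots> \<le> (\<Sum>b<j. ?r b + 1)" by (intro sum_mono) auto
    finally show ?thesis by (simp add: sum.distrib)
  qed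
  moreover have "0 \<le> (\<Sum>b<j. ?r b)" by (intro sum_nonneg) auto
  ultimately show ?thesis by blast
qed

end

section \<open>Covering the edges of a graph by vertices and odd sets\<close>

lemma matching_card_le:
  assumes "finite E" "matching E M"
  shows "card M \<le> matching_number E"
proof -
  have "finite {M. matching E M}"
    by (rule finite_subset[of _ "Pow E"]) (use assms(1) in \<open>auto simp: matching_def\<close>)
  then show ?thesis unfolding matching_number_def using assms(2) by (intro Max_ge) auto
qed

lemma exists_maximum_matching:
  assumes "finite E"
  obtains M where "matching E M" "card M = matching_number E"
proof -
  have "finite {M. matching E M}"
    by (rule finite_subset[of _ "Pow E"]) (use assms in \<open>auto simp: matching_def\<close>)
  moreover have "matching E {}" by (simp add: matching_def)
  ultimately have "matching_number E \<in> card ` {M. matching E M}"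
    unfolding matching_number_def by (intro Max_in) auto
  with that show thesis by auto
qed

lemma matching_mono: "matching E M \<Longrightarrow> E \<subseteq> F \<Longrightarrow> matching F M"
  by (auto simp: matching_def)

lemma matching_disjoint: "matching E M \<Longrightarrow> e \<in> M \<Longrightarrow> f \<in> M \<Longrightarrow> x \<in> e \<Longrightarrow> x \<in> f \<Longrightarrow> e = f"
  by (auto simp: matching_def pairwise_def disjnt_def)

lemma matching_exchange:
  assumes "matching E M" "e \<in> E" "\<And>f x. f \<in> M - {d} \<Longrightarrow> x \<in> e \<Longrightarrow> x \<notin> f"
  shows "matching E (insert e (M - {d}))"
  using assms by (auto simp: matching_def pairwise_def disjnt_def)

section \<open>Maximum matchings and Gallai's relation\<close>

locale edge_set =
  fixes E :: "'a set set"
  assumes finite_E: "finite E" and card_edge: "e \<in> E \<Longrightarrow> card e = 2"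
begin

definition maximum :: "'a set set \<Rightarrow> bool" where
  "maximum M \<longleftrightarrow> matching E M \<and> card M = matching_number E"

lemma maximum_finite: "maximum M \<Longrightarrow> finite M"
  using finite_E by (auto simp: maximum_def matching_def intro: finite_subset)

lemma maximum_subset: "maximum M \<Longrightarrow> M \<subseteq> E" by (simp add: maximum_def matching_def)

lemma finite_edge: "e \<in> E \<Longrightarrow> finite e"
  using card_edge by (metis card.infinite zero_neq_numeral)

lemma card_covered:
  assumes "matching E M"
  shows "card (\<Union>M) = 2 * card M"
proof -
  have "card (\<Union>M) = (\<Sum>e\<in>M. card e)"
    using assms by (intro card_Union_disjoint) (auto simp: matching_def intro!: finite_edge)
  also have "\<dots> = (\<Sum>e\<in>M. 2)"
    using assms card_edge by (intro sum.cong) (auto simp: matching_def)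
  finally show ?thesis by simp
qed

text \<open>Otherwise the edge could be added to the matching.\<close>

lemma maximum_meets_edge:
  assumes "maximum M" "e \<in> E"
  shows "e \<inter> \<Union>M \<noteq> {}"
proof
  assume *: "e \<inter> \<Union>M = {}"
  have "e \<noteq> {}" using card_edge[OF assms(2)] by auto
  with * have "e \<notin> M" by auto
  moreover have "matching E (insert e M)"
    using assms * by (auto simp: maximum_def matching_def pairwise_def disjnt_def)
  ultimately show False
    using matching_card_le[OF finite_E, of "insert e M"] maximum_finite[OF assms(1)] assms(1)
    by (simp add: maximum_def)
qed

text \<open>The disjunct \<open>x = y\<close> makes the relation reflexive also at vertices that
  some maximum matching misses.\<close>

definition linked :: "'a \<Rightarrow> 'a \<Rightarrow> bool" where
  "linked x y \<longleftrightarrow> x = y \<or> \<not> (\<exists>M. maximum M \<and> x \<notin> \<Union>M \<and> y \<notin> \<Union>M)"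

text \<open>Gallai's lemma: if \<open>N\<close> misses \<open>x\<close> and \<open>z\<close>, then a maximum matching that misses \<open>y\<close> and
  agrees with \<open>N\<close> as much as possible could still be exchanged towards \<open>N\<close>.\<close>
lemma linked_trans:
  assumes missed: "\<exists>M. maximum M \<and> y \<notin> \<Union>M" and xy: "linked x y" and yz: "linked y z"
  shows "linked x z"
proof (rule ccontr)
  assume "\<not> linked x z"
  then obtain N where N: "maximum N" "x \<notin> \<Union>N" "z \<notin> \<Union>N" and xz: "x \<noteq> z"
    by (auto simp: linked_def)
  have y: "y \<noteq> x" "y \<noteq> z" using xy yz \<open>\<not> linked x z\<close> by auto
  have yN: "y \<in> \<Union>N" using xy N y by (auto simp: linked_def)
  let ?A = "{M. maximum M \<and> y \<notin> \<Union>M}"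
  have "finite ?A"
    by (rule finite_subset[of _ "Pow E"]) (use finite_E in \<open>auto dest: maximum_subset\<close>)
  moreover have "?A \<noteq> {}" using missed by auto
  ultimately have "Max ((\<lambda>M. card (M \<inter> N)) ` ?A) \<in> (\<lambda>M. card (M \<inter> N)) ` ?A"
    by (intro Max_in) auto
  then obtain M where M: "maximum M" "y \<notin> \<Union>M"
    and M_max: "Max ((\<lambda>M. card (M \<inter> N)) ` ?A) = card (M \<inter> N)" by auto
  have best: "card (M' \<inter> N) \<le> card (M \<inter> N)" if "maximum M'" "y \<notin> \<Union>M'" for M'
    unfolding M_max[symmetric] using that \<open>finite ?A\<close> by (intro Max_ge) auto
  have xM: "x \<in> \<Union>M" and zM: "z \<in> \<Union>M" using xy yz M y by (auto simp: linked_def)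
  have fin: "finite (\<Union>M)" "finite (\<Union>N)"
    using M(1) N(1) maximum_finite maximum_subset finite_edge by blast+
  have "card (\<Union>M) = card (\<Union>N)" using M(1) N(1) by (simp add: card_covered maximum_def)
  \<comment> \<open>\<open>M\<close> and \<open>N\<close> cover equally many vertices, and
    \<open>x\<close> and \<open>z\<close> are covered by \<open>M\<close> alone. So at least two
    vertices are covered by \<open>N\<close> alone, and one of them is not \<open>y\<close>.\<close>
  then have "card (\<Union>M - \<Union>N) = card (\<Union>N - \<Union>M)"
    using fin card_Int_Diff[of "\<Union>M" "\<Union>N"] card_Int_Diff[of "\<Union>N" "\<Union>M"] by (simp add: Int_commute)
  moreover have "card {x, z} \<le> card (\<Union>M - \<Union>N)"
    using fin xM zM N by (intro card_mono) auto
  ultimately have "\<not> \<Union>N - \<Union>M \<subseteq> {y}"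
    using xz card_mono[of "{y}" "\<Union>N - \<Union>M"] by auto
  then obtain t where t: "t \<in> \<Union>N" "t \<notin> \<Union>M" "t \<noteq> y" by auto
  then obtain e where e: "e \<in> N" "t \<in> e" by auto
  have eE: "e \<in> E" using e N(1) maximum_subset by auto
  then obtain w where w: "e = {t, w}" "w \<noteq> t" using card_edge[OF eE] e(2) by (auto simp: card_2_iff)
  have "w \<in> \<Union>M" using maximum_meets_edge[OF M(1) eE] w t by auto
  then obtain d where d: "d \<in> M" "w \<in> d" by auto
  have dN: "d \<notin> N" using matching_disjoint[of E N d e w] N(1) e d w t by (auto simp: maximum_def)
  \<comment> \<open>Exchanging \<open>d\<close> for \<open>e\<close> keeps the size and still misses
    \<open>y\<close>. It gains the edge \<open>e\<close> of \<open>N\<close> and loses none, as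
    \<open>d\<close> is not in \<open>N\<close>.\<close>
  define M' where "M' = insert e (M - {d})"
  have eM: "e \<notin> M" using t e by auto
  have "matching E M'"
    unfolding M'_def
  proof (rule matching_exchange)
    fix f v assume f: "f \<in> M - {d}" "v \<in> e"
    show "v \<notin> f"
    proof
      assume "v \<in> f"
      then have "v = w" using f w t by auto
      then show False using matching_disjoint[of E M f d w] M(1) f d \<open>v \<in> f\<close> by (auto simp: maximum_def)
    qed
  qed (use M(1) eE in \<open>auto simp: maximum_def\<close>)
  moreover have "card M' = card M"
  proof -
    have "0 < card M" using maximum_finite[OF M(1)] d by (auto simp: card_gt_0_iff)
    then show ?thesis using maximum_finite[OF M(1)] d eM by (simp add: M'_def)
  qed
  ultimately have "maximum M'" using M(1) by (simp add: maximum_def)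
  moreover have "w \<noteq> y" using d M(2) by auto
  then have "y \<notin> \<Union>M'" using M(2) w t by (auto simp: M'_def)
  moreover have "M' \<inter> N = insert e (M \<inter> N)" using e dN by (auto simp: M'_def)
  then have "card (M' \<inter> N) = Suc (card (M \<inter> N))" using eM maximum_finite[OF M(1)] by simp
  ultimately show False using best by fastforce
qed

text \<open>By \<open>linked_trans\<close> the relation \<open>linked\<close> is an equivalence, and
  \<open>W\<close> consists of its classes. The ends of an edge are linked, so edges stay inside
  classes. A maximum matching misses at most one vertex of a class and therefore has at least half
  its size, rounded down, many edges inside it.\<close>

lemma factor_critical_cover:
  assumes missed: "\<And>v. \<exists>M. maximum M \<and> v \<notin> \<Union>M"
  shows "\<exists>W. finite W \<and> (\<forall>w\<in>W. finite w) \<and> (\<forall>e\<in>E. \<exists>w\<in>W. e \<subseteq> w) \<and>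
    (\<Sum>w\<in>W. card w div 2) \<le> matching_number E"
proof -
  define cls where "cls x = {y \<in> \<Union>E. linked x y}" for x
  define W where "W = cls ` \<Union>E"
  have fin: "finite (\<Union>E)" using finite_E finite_edge by auto
  have fin_cls: "finite (cls x)" for x
    by (rule finite_subset[OF _ fin]) (auto simp: cls_def)
  have sym: "linked x y \<Longrightarrow> linked y x" for x y by (auto simp: linked_def)
  have trans: "linked x y \<Longrightarrow> linked y z \<Longrightarrow> linked x z" for x y z
    using linked_trans missed by blast
  have cls_eq: "cls x = cls y" if "linked x y" for x y
  proof -
    have "linked x w \<longleftrightarrow> linked y w" for w using that sym trans by blast
    then show ?thesis by (simp add: cls_def)
  qed
  have cls_mem: "cls y = w" if "y \<in> w" "w \<in> W" for y w
  proof -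
    obtain x where "w = cls x" using \<open>w \<in> W\<close> by (auto simp: W_def)
    with \<open>y \<in> w\<close> cls_eq[of x y] show ?thesis by (simp add: cls_def)
  qed
  have edge: "linked x y" if e: "e \<in> E" "x \<in> e" "y \<in> e" for e x y
  proof (cases "x = y")
    case False
    then have "e = {x, y}" using card_edge[OF e(1)] e by (auto simp: card_2_iff)
    then show ?thesis using maximum_meets_edge[OF _ e(1)] by (auto simp: linked_def)
  qed (simp add: linked_def)
  have edge_in: "e \<subseteq> cls x" if "e \<in> E" "x \<in> e" for e x
    using edge that by (auto simp: cls_def)
  obtain M where M: "maximum M"
    using exists_maximum_matching[OF finite_E] by (auto simp: maximum_def)
  have half: "card w div 2 \<le> card {e \<in> M. e \<subseteq> w}" if "w \<in> W" for w
  proof -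
    obtain x where x: "x \<in> \<Union>E" "w = cls x" using \<open>w \<in> W\<close> by (auto simp: W_def)
    have finw: "finite w" using fin_cls by (simp add: x)
    let ?M = "{e \<in> M. e \<subseteq> w}"
    have M_w: "matching E ?M" using M by (auto simp: maximum_def matching_def intro: pairwise_subset)
    have "w \<inter> \<Union>M \<subseteq> \<Union>?M"
    proof clarify
      fix y e assume y: "y \<in> w" "e \<in> M" "y \<in> e"
      then have "e \<subseteq> cls y" using M by (intro edge_in) (auto dest: maximum_subset)
      moreover have "cls y = w" using y(1) that by (rule cls_mem)
      ultimately show "y \<in> \<Union>?M" using y by auto
    qed
    then have "card (w \<inter> \<Union>M) \<le> 2 * card ?M"
      unfolding card_covered[OF M_w, symmetric] using finw by (intro card_mono) (auto intro: finite_subset)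
    moreover have "card (w - \<Union>M) \<le> 1"
    proof -
      have "\<exists>y. w - \<Union>M \<subseteq> {y}"
      proof (cases "w - \<Union>M = {}")
        case False
        then obtain y where y: "y \<in> w - \<Union>M" by blast
        \<comment> \<open>Two vertices missed by the same maximum matching are linked only if they
          are equal.\<close>
        have "y' = y" if "y' \<in> w - \<Union>M" for y'
        proof -
          have "linked x y" "linked x y'" using y that by (auto simp: x cls_def)
          then have "linked y y'" using trans sym by blast
          then show ?thesis using M y that by (auto simp: linked_def)
        qed
        then have "w - \<Union>M \<subseteq> {y}" by blast
        then show ?thesis by blast
      qed auto
      then obtain y where "w - \<Union>M \<subseteq> {y}" by blast
      from card_mono[OF _ this] show ?thesis by simp
    qed
    moreover have "card w = card (w \<inter> \<Union>M) + card (w - \<Union>M)"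
      using card_Int_Diff[OF finw] .
    ultimately show ?thesis by linarith
  qed
  have disj: "{e \<in> M. e \<subseteq> w} \<inter> {e \<in> M. e \<subseteq> w'} = {}" if w: "w \<in> W" "w' \<in> W" "w \<noteq> w'" for w w'
  proof (rule ccontr)
    assume "{e \<in> M. e \<subseteq> w} \<inter> {e \<in> M. e \<subseteq> w'} \<noteq> {}"
    then obtain e where e: "e \<in> M" "e \<subseteq> w" "e \<subseteq> w'" by auto
    then have "card e = 2" using M maximum_subset card_edge by blast
    then obtain y where "y \<in> e" by (metis card.empty ex_in_conv zero_neq_numeral)
    then have "y \<in> w" "y \<in> w'" using e by auto
    then show False using cls_mem w by blast
  qed
  have finW: "finite W" using fin by (simp add: W_def)
  have "(\<Sum>w\<in>W. card w div 2) \<le> (\<Sum>w\<in>W. card {e \<in> M. e \<subseteq> w})"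
    using half by (rule sum_mono)
  also have "\<dots> = card (\<Union>w\<in>W. {e \<in> M. e \<subseteq> w})"
    using finW disj maximum_finite[OF M] by (intro card_UN_disjoint[symmetric]) auto
  also have "\<dots> \<le> card M" using maximum_finite[OF M] by (intro card_mono) auto
  finally have "(\<Sum>w\<in>W. card w div 2) \<le> matching_number E" using M by (simp add: maximum_def)
  moreover have "\<forall>e\<in>E. \<exists>w\<in>W. e \<subseteq> w"
  proof
    fix e assume e: "e \<in> E"
    then obtain x where "x \<in> e" using card_edge by (metis card.empty ex_in_conv zero_neq_numeral)
    then show "\<exists>w\<in>W. e \<subseteq> w" using edge_in[OF e] e by (auto simp: W_def)
  qed
  moreover have "\<forall>w\<in>W. finite w" using fin_cls by (auto simp: W_def)
  ultimately show ?thesis using finW by blast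
qed

end

text \<open>If every maximum matching covers \<open>v\<close>, deleting the edges at
  \<open>v\<close> lowers the matching number, which pays for putting \<open>v\<close> into
  \<open>U\<close>. If there is no such \<open>v\<close>, the classes of
  \<open>factor_critical_cover\<close> suffice.\<close>

theorem tutte_berge_cover:
  assumes "finite E" "\<And>e. e \<in> E \<Longrightarrow> card e = 2"
  shows "\<exists>U W. finite U \<and> finite W \<and> (\<forall>w\<in>W. finite w) \<and> (\<forall>e\<in>E. U \<inter> e \<noteq> {} \<or> (\<exists>w\<in>W. e \<subseteq> w)) \<and>
    card U + (\<Sum>w\<in>W. card w div 2) \<le> matching_number E"
  using assms
proof (induction "card E" arbitrary: E rule: less_induct)
  case less
  interpret edge_set E using less.prems by unfold_locales
  show ?case
  proof (cases "\<forall>v. \<exists>M. maximum M \<and> v \<notin> \<Union>M")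
    case True
    then obtain W where "finite W" "\<forall>w\<in>W. finite w" "\<forall>e\<in>E. \<exists>w\<in>W. e \<subseteq> w"
      "(\<Sum>w\<in>W. card w div 2) \<le> matching_number E" using factor_critical_cover by blast
    then show ?thesis by (intro exI[of _ "{}"] exI[of _ W]) auto
  next
    case False
    then obtain v where v: "\<And>M. maximum M \<Longrightarrow> v \<in> \<Union>M" by auto
    define F where "F = {e \<in> E. v \<notin> e}"
    have F: "F \<subseteq> E" "finite F" using finite_E by (auto simp: F_def)
    obtain M where "maximum M" using exists_maximum_matching[OF finite_E] by (auto simp: maximum_def)
    then have "F \<noteq> E" using v maximum_subset by (fastforce simp: F_def)
    then have "card F < card E" using F finite_E by (intro psubset_card_mono) auto
    from less.hyps[OF this F(2)] obtain U W where UW: "finite U" "finite W" "\<forall>w\<in>W. finite w"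
      "\<forall>e\<in>F. U \<inter> e \<noteq> {} \<or> (\<exists>w\<in>W. e \<subseteq> w)"
      "card U + (\<Sum>w\<in>W. card w div 2) \<le> matching_number F" using F card_edge by blast
    have "matching_number F < matching_number E"
    proof -
      obtain N where N: "matching F N" "card N = matching_number F"
        using exists_maximum_matching[OF F(2)] .
      have "v \<notin> \<Union>N" using N by (auto simp: matching_def F_def)
      then have "\<not> maximum N" using v by blast
      then show ?thesis
        using matching_card_le[OF finite_E] matching_mono[OF N(1) F(1)] N(2)
        by (fastforce simp: maximum_def)
    qed
    moreover have "card (insert v U) \<le> Suc (card U)" using UW(1) by (simp add: card_insert_if)
    ultimately have "card (insert v U) + (\<Sum>w\<in>W. card w div 2) \<le> matching_number E"
      using UW(5) by linarith
    moreover have "\<forall>e\<in>E. insert v U \<inter> e \<noteq> {} \<or> (\<exists>w\<in>W. e \<subseteq> w)"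
      using UW(4) by (auto simp: F_def)
    ultimately show ?thesis using UW(1-3) by (intro exI[of _ "insert v U"] exI[of _ W]) auto
  qed
qed

section \<open>Bounds on the sum of the largest Laplacian eigenvalues\<close>

text \<open>Union bound: counting an element several times does no harm to nonnegative
  weights.\<close>

lemma sum_le_sum_cover:
  fixes f :: "'b \<Rightarrow> real"
  assumes "finite I" "\<And>i. i \<in> I \<Longrightarrow> finite (A i)" "\<And>i x. i \<in> I \<Longrightarrow> x \<in> A i \<Longrightarrow> 0 \<le> f x"
    and "B \<subseteq> (\<Union>i\<in>I. A i)"
  shows "sum f B \<le> (\<Sum>i\<in>I. sum f (A i))"
  using assms
proof (induction I arbitrary: B rule: finite_induct)
  case (insert i I)
  have fin: "finite B" using insert.prems(1,3) insert.hyps by (auto intro: finite_subset)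
  have "sum f B = sum f (B \<inter> A i) + sum f (B - A i)"
    using fin by (metis sum.Int_Diff)
  moreover have "sum f (B \<inter> A i) \<le> sum f (A i)"
    using insert.prems by (intro sum_mono2) auto
  moreover have "sum f (B - A i) \<le> (\<Sum>i\<in>I. sum f (A i))"
    using insert.prems by (intro insert.IH) auto
  ultimately show ?case using insert.hyps by simp
qed simp

context block_weights
begin

text \<open>The arcs in \<open>A\<close>, the pairs outside \<open>C\<close> and the diagonal of
  \<open>C\<close> are disjoint. Taking the last two off \<open>total_sum\<close> cancels the term
  \<open>card V\<close>.\<close>

lemma covered_arc_sum:
  assumes C: "C \<subseteq> V" and A: "A \<subseteq> {(u, v). u \<in> V \<and> v \<in> V \<and> u \<noteq> v \<and> (u \<in> C \<or> v \<in> C)}"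
  shows "\<exists>\<rho>\<ge>0. real (card V) - real j - real (card C) \<le> \<rho> \<and>
    (\<Sum>(u, v)\<in>A. pair_weight u v) \<le> (real (card V) - real j)\<^sup>2 + (real (card V) - real j) - \<rho>\<^sup>2 - \<rho>"
proof -
  obtain \<rho> where rho: "0 \<le> \<rho>" "real (card V) - real j - real (card C) \<le> \<rho>"
    "\<rho>\<^sup>2 + \<rho> + real (card (V - C)) \<le> (\<Sum>u\<in>V - C. \<Sum>v\<in>V - C. pair_weight u v)"
    using remaining_sum[OF C] by blast
  have finC: "finite C" using C finite by (rule finite_subset)
  have finA: "finite A" by (rule finite_subset[of _ "V \<times> V"]) (use A finite in auto)
  let ?D = "(\<lambda>u. (u, u)) ` C"
  have disj: "A \<inter> (V - C) \<times> (V - C) = {}" "(A \<union> (V - C) \<times> (V - C)) \<inter> ?D = {}"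
    using A by auto
  have "(\<Sum>(u, v)\<in>A. pair_weight u v) + (\<Sum>(u, v)\<in>(V - C) \<times> (V - C). pair_weight u v) + (\<Sum>(u, v)\<in>?D. pair_weight u v) =
      (\<Sum>(u, v)\<in>A \<union> (V - C) \<times> (V - C) \<union> ?D. pair_weight u v)"
    using finA finC finite sum.union_disjoint[OF _ _ disj(1), of "\<lambda>(u, v). pair_weight u v"]
      sum.union_disjoint[OF _ _ disj(2), of "\<lambda>(u, v). pair_weight u v"] by simp
  also have "\<dots> \<le> (\<Sum>(u, v)\<in>V \<times> V. pair_weight u v)"
    using A C finite by (intro sum_mono2) (auto intro: pair_weight_nonneg)
  also have "\<dots> = (real (card V) - real j)\<^sup>2 + (real (card V) - real j) + real (card V)"
    by (simp add: total_sum flip: sum.cartesian_product)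
  finally have "(\<Sum>(u, v)\<in>A. pair_weight u v) + (\<Sum>u\<in>V - C. \<Sum>v\<in>V - C. pair_weight u v) + (\<Sum>(u, v)\<in>?D. pair_weight u v) \<le>
      (real (card V) - real j)\<^sup>2 + (real (card V) - real j) + real (card V)"
    by (simp add: sum.cartesian_product)
  moreover have "(\<Sum>(u, v)\<in>?D. pair_weight u v) = real (card C)"
  proof -
    have "(\<Sum>(u, v)\<in>?D. pair_weight u v) = (\<Sum>u\<in>C. pair_weight u u)" by (subst sum.reindex) (auto simp: inj_on_def)
    also have "\<dots> = (\<Sum>u\<in>C. 1)" using C weight_own by (intro sum.cong) (auto simp: pair_weight_def)
    finally show ?thesis by simp
  qed
  moreover have "real (card (V - C)) = real (card V) - real (card C)"
    using C finite finC by (simp add: card_Diff_subset card_mono of_nat_diff)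
  ultimately have "(\<Sum>(u, v)\<in>A. pair_weight u v) \<le> (real (card V) - real j)\<^sup>2 + (real (card V) - real j) - \<rho>\<^sup>2 - \<rho>"
    using rho(3) by linarith
  with rho show ?thesis by blast
qed

end

lemma laplacian_sum_le:
  assumes "2 * laplacian_sum V E k \<le> (\<Sum>(u, v)\<in>arcs E. 1 + H u v)"
    and "simple_graph V E" "(\<Sum>(u, v)\<in>arcs E. H u v) \<le> 2 * B"
  shows "laplacian_sum V E k \<le> real (card E) + B"
proof -
  have "(\<Sum>(u, v)\<in>arcs E. 1 + H u v) = 2 * real (card E) + (\<Sum>(u, v)\<in>arcs E. H u v)"
    by (simp add: case_prod_unfold sum.distrib card_arcs[OF assms(2)])
  with assms show ?thesis by simp
qed

lemma real_choose_two: "real (n choose 2) = real n * (real n - 1) / 2"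
  by (induction n) (auto simp: numeral_2_eq_2 field_simps)

text \<open>With \<open>t = card C <= K\<close> and \<open>\<rho> = K - t\<close> the weight bound
  equals \<open>2 K t - t (t - 1)\<close>, and \<open>K <= k\<close>. For \<open>K < t\<close> the
  crude bound \<open>K^2 + K\<close> is already small enough.\<close>

theorem laplacian_sum_vertex_cover_bound:
  assumes G: "simple_graph V E" and C: "vertex_cover V E C" "card C \<le> k" and k: "k \<le> card V"
  shows "laplacian_sum V E k \<le> real (card E) + (real k * real (card C) - real (card C choose 2))"
proof (cases "V = {}")
  case True
  \<comment> \<open>\<open>laplacian_sum_block_bound\<close> asks for a vertex, so the empty graph
    is treated directly.\<close>
  then have "C = {}" "k = 0" using C k by (auto simp: vertex_cover_def)
  then show ?thesis by (simp add: laplacian_sum_def numeral_2_eq_2)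
next
  case False
  obtain j \<phi> z where bw: "block_weights V j \<phi> z" and j: "card V \<le> j + k"
    and s: "2 * laplacian_sum V E k \<le> (\<Sum>(u, v)\<in>arcs E. 1 + z u (\<phi> v) * z v (\<phi> u))"
    using laplacian_sum_block_bound[OF G False k] .
  interpret block_weights V j \<phi> z by (rule bw)
  define K where "K = real (card V) - real j"
  have K: "0 \<le> K" "K \<le> real k" using j j_le_card by (auto simp: K_def)
  have "arcs E \<subseteq> {(u, v). u \<in> V \<and> v \<in> V \<and> u \<noteq> v \<and> (u \<in> C \<or> v \<in> C)}"
    using arcs_subset[OF G] C(1) by (auto simp: arcs_def vertex_cover_def)
  with C(1) obtain \<rho> where rho: "0 \<le> \<rho>" "K - real (card C) \<le> \<rho>"
    "(\<Sum>(u, v)\<in>arcs E. pair_weight u v) \<le> K\<^sup>2 + K - \<rho>\<^sup>2 - \<rho>"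
    unfolding K_def using covered_arc_sum[of C "arcs E"] by (auto simp: vertex_cover_def)
  let ?t = "real (card C)"
  have choose: "2 * real (card C choose 2) = ?t * ?t - ?t"
    by (simp add: real_choose_two field_simps)
  have "K\<^sup>2 + K - \<rho>\<^sup>2 - \<rho> \<le> 2 * (real k * ?t - real (card C choose 2))"
  proof (cases "?t \<le> K")
    case True
    have "(K - ?t)\<^sup>2 \<le> \<rho>\<^sup>2" using True rho by (intro power_mono) auto
    moreover have "K * ?t \<le> real k * ?t" using K by (intro mult_right_mono) auto
    ultimately show ?thesis using rho choose by (simp add: power2_eq_square algebra_simps)
  next
    case False
    \<comment> \<open>Here \<open>K^2 + K <= t^2 + t <= k t + t\<close>, and \<open>t <= k\<close>
      gives \<open>k t + t <= 2 k t - t (t - 1)\<close>.\<close>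
    then have "K\<^sup>2 \<le> ?t * ?t" using K by (auto simp: power2_eq_square intro!: mult_mono)
    moreover have "?t * ?t \<le> real k * ?t" using C(2) by (intro mult_right_mono) auto
    moreover have "0 \<le> \<rho>\<^sup>2" by simp
    ultimately have "K\<^sup>2 + K - \<rho>\<^sup>2 - \<rho> \<le> real k * ?t + ?t" using rho(1) False by linarith
    also have "\<dots> \<le> 2 * (real k * ?t - real (card C choose 2))"
      using choose \<open>?t * ?t \<le> real k * ?t\<close> by simp
    finally show ?thesis .
  qed
  with rho have "(\<Sum>(u, v)\<in>arcs E. pair_weight u v) \<le> 2 * (real k * ?t - real (card C choose 2))" by simp
  from laplacian_sum_le[OF s G this[unfolded pair_weight_def]] show ?thesis .
qed

text \<open>For \<open>k < 2 * matching_number E\<close> the weight of all pairs is small enough.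
  Otherwise the arcs are covered by stars and by pairs inside the sets of a Tutte-Berge cover, each
  charged \<open>2 k\<close> times its share of the matching number.\<close>

theorem laplacian_sum_matching_bound:
  assumes G: "simple_graph V E" and k: "k + 2 \<le> card (non_isolated V E)"
  shows "laplacian_sum V E k \<le> real (card E) + real k * real (matching_number E)"
proof -
  have fin: "finite V" using G by (simp add: simple_graph_def)
  have finE: "finite E"
    by (rule finite_subset[of _ "Pow V"]) (use G in \<open>auto simp: simple_graph_def\<close>)
  have card_edge: "card e = 2" if "e \<in> E" for e using G that by (simp add: simple_graph_def)
  have "card (non_isolated V E) \<le> card V" using fin by (intro card_mono) (auto simp: non_isolated_def)
  with k have kV: "k \<le> card V" and V: "V \<noteq> {}" by auto
  obtain j \<phi> z where bw: "block_weights V j \<phi> z" and j: "card V \<le> j + k"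
    and s: "2 * laplacian_sum V E k \<le> (\<Sum>(u, v)\<in>arcs E. 1 + z u (\<phi> v) * z v (\<phi> u))"
    using laplacian_sum_block_bound[OF G V kV] .
  interpret block_weights V j \<phi> z by (rule bw)
  define K where "K = real (card V) - real j"
  have K: "0 \<le> K" "K \<le> real k" using j j_le_card by (auto simp: K_def)
  let ?nu = "matching_number E"
  have "(\<Sum>(u, v)\<in>arcs E. pair_weight u v) \<le> 2 * (real k * real ?nu)"
  proof (cases "k < 2 * ?nu")
    case True
    \<comment> \<open>Taking all of \<open>V\<close> as the cover bounds the total weight by
      \<open>K (K + 1)\<close>, and here \<open>K + 1 <= k + 1 <= 2 * ?nu\<close>.\<close>
    have "arcs E \<subseteq> {(u, v). u \<in> V \<and> v \<in> V \<and> u \<noteq> v \<and> (u \<in> V \<or> v \<in> V)}"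
      using arcs_subset[OF G] by auto
    from covered_arc_sum[OF order_refl this] obtain \<rho> where "0 \<le> \<rho>"
      "(\<Sum>(u, v)\<in>arcs E. pair_weight u v) \<le> K\<^sup>2 + K - \<rho>\<^sup>2 - \<rho>" by (auto simp: K_def)
    moreover have "0 \<le> \<rho>\<^sup>2" by simp
    ultimately have "(\<Sum>(u, v)\<in>arcs E. pair_weight u v) \<le> K\<^sup>2 + K" by linarith
    also have "\<dots> = K * (K + 1)" by (simp add: power2_eq_square algebra_simps)
    also have "\<dots> \<le> real k * (2 * real ?nu)" using K True by (intro mult_mono) auto
    finally show ?thesis by simp
  next
    case False
    obtain U W where U: "finite U" and W: "finite W" "\<forall>w\<in>W. finite w"
      and cover: "\<forall>e\<in>E. U \<inter> e \<noteq> {} \<or> (\<exists>w\<in>W. e \<subseteq> w)"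
      and count: "card U + (\<Sum>w\<in>W. card w div 2) \<le> ?nu"
      using tutte_berge_cover[OF finE card_edge] by blast
    \<comment> \<open>Both orders of each pair occur. The sets are cut down to \<open>V\<close>, in
      which the Tutte-Berge cover need not lie.\<close>
    define A where "A c = {c} \<times> (V - {c}) \<union> (V - {c}) \<times> {c}" for c
    define B where "B w = {(u, v). u \<in> w \<inter> V \<and> v \<in> w \<inter> V \<and> u \<noteq> v}" for w
    have A: "sum (\<lambda>(u, v). pair_weight u v) (A c) \<le> 2 * real k" if c: "c \<in> U \<inter> V" for c
    proof -
      have "sum (\<lambda>(u, v). pair_weight u v) (A c) =
          (\<Sum>(u, v)\<in>{c} \<times> (V - {c}). pair_weight u v) + (\<Sum>(u, v)\<in>(V - {c}) \<times> {c}. pair_weight u v)"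
        unfolding A_def using finite by (intro sum.union_disjoint) auto
      also have "\<dots> = (\<Sum>v\<in>V - {c}. pair_weight c v) + (\<Sum>v\<in>V - {c}. pair_weight v c)"
        by (simp flip: sum.cartesian_product)
      also have "\<dots> \<le> 2 * K" using star_sum[of c] c by (simp add: pair_weight_commute[of _ c] K_def)
      finally show ?thesis using K by simp
    qed
    have half: "card w * (card w - 1) \<le> 2 * k * (card w div 2)" if w: "w \<in> W" for w
    proof -
      define m where "m = card w div 2"
      have le: "m + (card U + (\<Sum>w\<in>W - {w}. card w div 2)) \<le> ?nu"
        using count W(1) w by (simp add: sum.remove[of W w] m_def)
      consider "card w = 2 * m" | "card w = 2 * m + 1" "2 * m + 1 \<le> k" | "card w = 2 * m + 1" "k \<le> 2 * m"
        unfolding m_def by linarith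
      then show ?thesis
      proof cases
        case 1
        have "2 * m - 1 \<le> k" using False le by linarith
        then have "2 * m * (2 * m - 1) \<le> 2 * m * k" by (rule mult_left_mono) simp
        then show ?thesis using 1 by (simp add: mult_ac)
      next
        case 2
        then have "2 * m * (2 * m + 1) \<le> 2 * m * k" by (intro mult_left_mono) auto
        then show ?thesis using 2 by (simp add: mult_ac)
      next
        case 3
        \<comment> \<open>Now \<open>k <= 2 * m <= 2 * ?nu <= k\<close>, so \<open>w\<close> uses up
          the whole count: \<open>U\<close> is empty and the other sets in \<open>W\<close> contain
          no edge. All non-isolated vertices then lie in \<open>w\<close>, which has only
          \<open>k + 1\<close> elements.\<close>
        have "card U + (\<Sum>w\<in>W - {w}. card w div 2) = 0" using 3 le False by linarith
        then have zero: "card U = 0" "(\<Sum>w\<in>W - {w}. card w div 2) = 0" by auto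
        have "U = {}" using zero(1) U by simp
        have small: "card w' \<le> 1" if "w' \<in> W" "w' \<noteq> w" for w'
        proof -
          have "card w' div 2 = 0" using zero(2) that W(1) by auto
          then show ?thesis by linarith
        qed
        have "e \<subseteq> w" if e: "e \<in> E" for e
        proof -
          obtain w' where w': "w' \<in> W" "e \<subseteq> w'" using cover e \<open>U = {}\<close> by auto
          have "card e \<le> card w'" using w' W(2) by (intro card_mono) auto
          then show ?thesis using small[OF w'(1)] card_edge[OF e] w'(2) by (cases "w' = w") auto
        qed
        then have "non_isolated V E \<subseteq> w"
        proof -
          have "\<exists>e\<in>E. v \<in> e" if "v \<in> non_isolated V E" for v
          proof (rule ccontr)
            assume "\<not> ?thesis"
            then have "{e \<in> E. v \<in> e} = {}" by auto
            then have "vdegree E v = 0" by (simp only: vdegree_def card.empty)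
            with that show False by (simp add: non_isolated_def)
          qed
          with \<open>\<And>e. e \<in> E \<Longrightarrow> e \<subseteq> w\<close> show ?thesis by blast
        qed
        then have "card (non_isolated V E) \<le> card w" using W(2) w by (intro card_mono) auto
        with 3 k le False have False by linarith
        then show ?thesis ..
      qed
    qed
    have B: "sum (\<lambda>(u, v). pair_weight u v) (B w) \<le> 2 * real k * real (card w div 2)" if w: "w \<in> W" for w
    proof -
      have finw: "finite w" using W w by auto
      have "sum (\<lambda>(u, v). pair_weight u v) (B w) \<le> (\<Sum>_\<in>B w. 1)"
        by (intro sum_mono) (auto simp: B_def intro: pair_weight_le_1)
      also have "\<dots> = real (card (B w))" by simp
      also have "card (B w) \<le> card (Sigma w (\<lambda>u. w - {u}))"
        using finw by (intro card_mono) (auto simp: B_def)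
      also have "card (Sigma w (\<lambda>u. w - {u})) = card w * (card w - 1)"
        using finw by (subst card_SigmaI) auto
      also have "\<dots> \<le> 2 * k * (card w div 2)" using half[OF w] .
      finally show ?thesis by simp
    qed
    \<comment> \<open>The sum type merges stars and sets into one family for the union
      bound.\<close>
    define F where "F i = (case i of Inl c \<Rightarrow> A c | Inr w \<Rightarrow> B w)" for i
    let ?I = "Inl ` (U \<inter> V) \<union> Inr ` W"
    have finI: "finite ?I" using U W by simp
    have "(\<Sum>(u, v)\<in>arcs E. pair_weight u v) \<le> (\<Sum>i\<in>?I. sum (\<lambda>(u, v). pair_weight u v) (F i))"
    proof (rule sum_le_sum_cover[OF finI])
      show "finite (F i)" if "i \<in> ?I" for i
      proof (rule finite_subset)
        show "F i \<subseteq> V \<times> V" using that by (auto simp: F_def A_def B_def)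
      qed (use finite in simp)
      show "0 \<le> (case x of (u, v) \<Rightarrow> pair_weight u v)" if "i \<in> ?I" "x \<in> F i" for i x
        using that by (auto simp: F_def A_def B_def intro: pair_weight_nonneg)
      show "arcs E \<subseteq> (\<Union>i\<in>?I. F i)"
      proof clarify
        fix u v assume uv: "(u, v) \<in> arcs E"
        then have V: "u \<in> V" "v \<in> V" "u \<noteq> v" using arcs_subset[OF G] by auto
        have "{u, v} \<in> E" using uv by (simp add: arcs_def)
        with cover have "U \<inter> {u, v} \<noteq> {} \<or> (\<exists>w\<in>W. {u, v} \<subseteq> w)" by (rule bspec)
        then consider "u \<in> U" | "v \<in> U" | w where "w \<in> W" "{u, v} \<subseteq> w" by blast
        then show "(u, v) \<in> (\<Union>i\<in>?I. F i)"
        proof cases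
          case 1
          then show ?thesis using V by (intro UN_I[of "Inl u"]) (auto simp: F_def A_def)
        next
          case 2
          then show ?thesis using V by (intro UN_I[of "Inl v"]) (auto simp: F_def A_def)
        next
          case 3
          then show ?thesis using V by (intro UN_I[of "Inr w"]) (auto simp: F_def B_def)
        qed
      qed
    qed
    also have "\<dots> = (\<Sum>c\<in>U \<inter> V. sum (\<lambda>(u, v). pair_weight u v) (A c)) + (\<Sum>w\<in>W. sum (\<lambda>(u, v). pair_weight u v) (B w))"
      using U W by (subst sum.union_disjoint) (auto simp: sum.reindex F_def)
    also have "\<dots> \<le> (\<Sum>c\<in>U \<inter> V. 2 * real k) + (\<Sum>w\<in>W. 2 * real k * real (card w div 2))"
      using A B by (intro add_mono sum_mono)
    also have "\<dots> = 2 * real k * real (card (U \<inter> V) + (\<Sum>w\<in>W. card w div 2))"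
      by (simp add: sum_distrib_left algebra_simps)
    also have "\<dots> \<le> 2 * real k * real ?nu"
    proof (rule mult_left_mono)
      have "card (U \<inter> V) \<le> card U" using U by (intro card_mono) auto
      then show "real (card (U \<inter> V) + (\<Sum>w\<in>W. card w div 2)) \<le> real ?nu"
        using count by (simp only: of_nat_le_iff)
    qed simp
    finally show ?thesis by simp
  qed
  from laplacian_sum_le[OF s G this[unfolded pair_weight_def]] show ?thesis .
qed

theorem theorem2:
  fixes V :: "'a set" and E :: "'a set set"
  assumes "simple_graph V E"
  shows
    "(\<forall>n k. card (non_isolated V E) = n \<and> 1 \<le> k \<and> k + 2 \<le> n \<longrightarrow>
        laplacian_sum V E k \<le> real (card E) + real k * real (matching_number E)) \<and>
     (\<forall>n k. card V = n \<and> vertex_cover_number V E \<le> k \<and> k \<le> n \<longrightarrow>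
        laplacian_sum V E k \<le> real (card E) + real k * real (vertex_cover_number V E)
          - real (vertex_cover_number V E choose 2))"
proof -
  have fin: "finite V" using assms by (simp add: simple_graph_def)
  have "finite {C. vertex_cover V E C}"
    by (rule finite_subset[of _ "Pow V"]) (use fin in \<open>auto simp: vertex_cover_def\<close>)
  \<comment> \<open>\<open>V\<close> is itself a cover, so the minimum is over a nonempty finite set
    and is attained by some \<open>C\<close>.\<close>
  moreover have "vertex_cover V E V"
    using assms unfolding vertex_cover_def simple_graph_def
    by (metis Int_absorb1 card.empty order_refl zero_neq_numeral)
  ultimately have "vertex_cover_number V E \<in> card ` {C. vertex_cover V E C}"
    unfolding vertex_cover_number_def by (intro Min_in) auto
  then obtain C where "vertex_cover V E C" "card C = vertex_cover_number V E" by auto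
  then have "laplacian_sum V E k \<le> real (card E) + real k * real (vertex_cover_number V E)
      - real (vertex_cover_number V E choose 2)" if "vertex_cover_number V E \<le> k" "k \<le> card V" for k
    using laplacian_sum_vertex_cover_bound[OF assms, of C k] that by simp
  then show ?thesis using laplacian_sum_matching_bound[OF assms] by blast
qed

end
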